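(* Let $i,k,\ell\in\mathbb{Z}$ with $k\ge 1$ and $0\le i\le k$. Then $$\frac{(-q^{1/2})_\infty}{(q)_\infty}\left(\sum_{n\ge|\ell|}-\sum_{n\le-|\ell|-1}\right)q^{\left(k+\frac12\right)\left(n+\frac{i}{2k+1}\right)^2-\frac{(2k\ell+i+\ell)^2}{4k+2}}$$ $$=\sum_{n_1,n_2,\dots,n_k\ge0}\frac{q^{\frac{N_1(N_1+1)}{2}+N_2^2+N_3^2+\cdots+N_k^2+\left(\ell+\frac12\right)N_1+(2\ell+1)(N_2+N_3+\cdots+N_k)-N_1-N_2-\cdots-N_{k-i}}\,(-q^{1/2})_{N_1+\ell}}{(q)_{n_1}(q)_{n_2}\cdots(q)_{n_k}\,(q)_{n_k+2\ell}},$$ where $N_j:=n_j+n_{j+1}+\cdots+n_k$ for $1\le j\le k$.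
   Context: Conventions: $q=e^{2\pi i\tau}$ with $\operatorname{Im}\tau>0$ (so $|q|<1$), and $q^r:=e^{2\pi i r\tau}$ for rational $r$ (here, in $e^{2\pi i\tau}$, $i$ is the imaginary unit; elsewhere $i$ is an integer index). The $q$-Pochhammer symbols are $(a)_n=(a;q)_n:=\prod_{j=1}^n(1-aq^{j-1})$ for $n\ge0$, $(a)_\infty:=\prod_{j\ge1}(1-aq^{j-1})$. By convention $1/(q)_m=0$ for integers $m<0$, so that summands on the right with $n_k+2\ell<0$ are zero. The expression $-N_1-N_2-\cdots-N_{k-i}$ means $-\sum_{j=1}^{k-i}N_j$, which is empty (zero) when $i=k$; likewise $N_2^2+\cdots+N_k^2$ and $N_2+\cdots+N_k$ are zero when $k=1$. The notation $\left(\sum_{n\ge|\ell|}-\sum_{n\le-|\ell|-1}\right)f(n)$ means $\sum_{n\ge|\ell|}f(n)-\sum_{n\le-|\ell|-1}f(n)$ with $n\in\mathbb{Z}$. *)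

theory Defs
  imports "HOL-Analysis.Analysis"
begin

text \<open>
  Fractional powers of the nome are taken as functions of \<open>\<tau>\<close>, not of \<open>q\<close>, so that no branch of a
  power function is chosen: \<open>qpow \<tau> r\<close> is $q^r = e^{2\pi i r\tau}$, and \<open>qpow \<tau> 1\<close> is $q$ itself.
\<close>

definition qpow :: "complex \<Rightarrow> real \<Rightarrow> complex" where
  "qpow \<tau> r = exp (2 * of_real pi * \<i> * of_real r * \<tau>)"

definition qpoch :: "complex \<Rightarrow> complex \<Rightarrow> nat \<Rightarrow> complex" where
  "qpoch a q n = (\<Prod>j=1..n. 1 - a * q ^ (j - 1))"

text \<open>The factors of \<open>prodinf\<close> start at index 0, so \<open>j\<close> here is $j - 1$ in $\prod_{j \ge 1} (1 - a q^{j-1})$.\<close>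

definition qpoch_inf :: "complex \<Rightarrow> complex \<Rightarrow> complex" where
  "qpoch_inf a q = (\<Prod>j. 1 - a * q ^ j)"

text \<open>$1/(q)_m$ for an integer $m$, with the convention that it vanishes for $m < 0$.\<close>

definition inv_qfact :: "complex \<Rightarrow> int \<Rightarrow> complex" where
  "inv_qfact q m = (if m < 0 then 0 else 1 / qpoch q q (nat m))"

definition tail_sum :: "nat \<Rightarrow> (nat \<Rightarrow> nat) \<Rightarrow> nat \<Rightarrow> nat" where
  "tail_sum k n j = (\<Sum>m=j..k. n m)"

definition theta_exponent :: "nat \<Rightarrow> nat \<Rightarrow> int \<Rightarrow> int \<Rightarrow> real" where
  "theta_exponent k i l n =
     (real k + 1/2) * (of_int n + real i / (2 * real k + 1))\<^sup>2
     - (2 * real k * of_int l + real i + of_int l)\<^sup>2 / (4 * real k + 2)"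

definition multisum_exponent :: "nat \<Rightarrow> nat \<Rightarrow> int \<Rightarrow> (nat \<Rightarrow> nat) \<Rightarrow> real" where
  "multisum_exponent k i l n =
     (let N = (\<lambda>j. real (tail_sum k n j)) in
        N 1 * (N 1 + 1) / 2 + (\<Sum>j=2..k. (N j)\<^sup>2)
        + (of_int l + 1/2) * N 1 + (2 * of_int l + 1) * (\<Sum>j=2..k. N j)
        - (\<Sum>j=1..k-i. N j))"

text \<open>
  The truncation in \<open>nat (N\<^sub>1 + l)\<close> is harmless: if $N_1 + l < 0$ then
  $n_k + 2l \le N_1 + 2l < l < 0$, and the last factor makes the summand vanish.
\<close>

definition multisum_term :: "complex \<Rightarrow> nat \<Rightarrow> nat \<Rightarrow> int \<Rightarrow> (nat \<Rightarrow> nat) \<Rightarrow> complex" where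
  "multisum_term \<tau> k i l n =
     qpow \<tau> (multisum_exponent k i l n)
     * qpoch (- qpow \<tau> (1/2)) (qpow \<tau> 1) (nat (int (tail_sum k n 1) + l))
     / (\<Prod>j=1..k. qpoch (qpow \<tau> 1) (qpow \<tau> 1) (n j))
     * inv_qfact (qpow \<tau> 1) (int (n k) + 2 * l)"

end

theory Submission
  imports Defs
begin

text \<open>
The identity is an instance of the Bailey chain, with one change of the Bailey parameter on the way.
Put $M_j = N_j + l$ and $L = |l|$. Completing squares turns the exponent of the multisum into
\[ \tfrac12 (M_1^2 - l^2) + \sum_{j=2}^{k} (M_j^2 - l^2) + \sum_{j > k-i} (M_j - l), \]
and the exponent of the theta function into $(k + \frac12)(n^2 - l^2) + i(n - l)$. The product of the
two last factors $1/(q)_{n_k} (q)_{n_k + 2l}$ is the kernel $1/(q)_{M_k - L} (q)_{M_k + L}$, so only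
$|l|$ matters there.

Write $B_c(r, M) = 1/(q)_{M-r} (q)_{M+r+c}$ with $c \in \{0, 1\}$ (the Bailey parameter is $a = q^c$).
Three facts carry the argument.

\<^item> Summing the innermost variable is a step of the Bailey chain: weight $q^{m^2 + cm}$ and factor
  $1/(q)_{M-m}$ map $B_c(r, m)$ to $q^{r^2 + cr} B_c(r, M)$ (\<open>sum_bailey_kernel\<close>).
\<^item> Summing the outermost variable, with weight $q^{m^2/2 + cm} (-q^{1/2})_m$ and no upper limit, maps
  $B_c(r, m)$ to an infinite product (\<open>sums_bailey_kernel\<close>).
\<^item> $(1 - q^{2r+1}) B_1(r, M) = B_0(r, M) - q^{2r+1} B_0(r+1, M)$ (\<open>bailey_kernel_1\<close>). Read as a
  telescoping sum it expands $B_0(L, \cdot)$ in the $B_1(r, \cdot)$, $r \ge L$, and it converts an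
  expansion in the $B_1(r, \cdot)$ back into one in the $B_0(r, \cdot)$.

So one expands $B_0(L, \cdot)$ in the kernels with $c = 1$, carries out the $i$ steps in which the
linear term $M_j$ is present, returns to $c = 0$, carries out the other $k - 1 - i$ steps, and sums
over $M_1$. The coefficient of each $r \ge L$ is then a difference of two terms of the theta series,
one from its positive and one from its negative part (when $i < k$, the second one is absent for
$r = L$). For $i = k$ the return to $c = 0$ does not take
place, and the last sum is the one with $c = 1$.

The first two facts are both specialisations of the limiting case
\[ \sum_{s \ge 0} \frac{(b)_s\, q^{s(s-1)/2} (-d)^s}{(q)_s (bd)_s} = \frac{(d)_\infty}{(bd)_\infty} \]
of the $q$-Gauss sum (\<open>qgauss_limit_sums\<close>): the first with $b = q^{-N}$, where the series terminates,
the second with $b = -q^{r + 1/2}$.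
\<close>

section \<open>The q-Pochhammer symbol\<close>

lemma qpoch_0 [simp]: "qpoch a q 0 = 1"
  by (simp add: qpoch_def)

lemma qpoch_Suc: "qpoch a q (Suc n) = qpoch a q n * (1 - a * q ^ n)"
  by (simp add: qpoch_def)

lemma qpoch_conv_lessThan: "qpoch a q n = (\<Prod>j<n. 1 - a * q ^ j)"
  by (induction n) (simp_all add: qpoch_Suc)

lemma qpoch_add: "qpoch a q (m + n) = qpoch a q m * qpoch (a * q ^ m) q n"
  by (induction n) (simp_all add: qpoch_Suc power_add mult_ac)

lemma qpoch_Suc_left: "qpoch a q (Suc n) = (1 - a) * qpoch (a * q) q n"
  using qpoch_add[of a q 1 n] by (simp add: qpoch_def)

lemma norm_mult_power_less_1:
  fixes a q :: complex
  assumes "norm q < 1" "norm a < 1"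
  shows "norm (a * q ^ n) < 1"
proof -
  have "norm (a * q ^ n) \<le> norm a * 1"
    unfolding norm_mult norm_power using assms by (intro mult_left_mono power_le_one) auto
  thus ?thesis using assms by simp
qed

lemma qpoch_nonzero:
  assumes "norm q < 1" "norm a < 1"
  shows "qpoch a q n \<noteq> 0"
proof -
  have "1 - a * q ^ j \<noteq> 0" for j
    using norm_mult_power_less_1[OF assms, of j] by auto
  thus ?thesis by (simp add: qpoch_conv_lessThan)
qed

lemma convergent_prod_qpoch:
  fixes a q :: complex
  assumes "norm q < 1"
  shows "convergent_prod (\<lambda>j. 1 - a * q ^ j)"
proof -
  have "summable (\<lambda>j. norm a * norm q ^ j)"
    using assms by (intro summable_mult summable_geometric) auto
  hence "summable (\<lambda>j. norm ((1 - a * q ^ j) - 1))"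
    by (simp add: norm_mult norm_power)
  thus ?thesis
    by (intro abs_convergent_prod_imp_convergent_prod summable_imp_abs_convergent_prod)
qed

lemma qpoch_tendsto:
  assumes "norm q < 1"
  shows "qpoch a q \<longlonglongrightarrow> qpoch_inf a q"
proof -
  have "(\<lambda>n. \<Prod>j\<le>n. 1 - a * q ^ j) \<longlonglongrightarrow> qpoch_inf a q"
    unfolding qpoch_inf_def by (rule convergent_prod_LIMSEQ[OF convergent_prod_qpoch[OF assms]])
  hence "(\<lambda>n. qpoch a q (Suc n)) \<longlonglongrightarrow> qpoch_inf a q"
    by (simp add: qpoch_conv_lessThan lessThan_Suc_atMost)
  thus ?thesis by (rule LIMSEQ_imp_Suc)
qed

lemma qpoch_inf_nonzero:
  assumes "norm q < 1" "norm a < 1"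
  shows "qpoch_inf a q \<noteq> 0"
proof -
  have "1 - a * q ^ j \<noteq> 0" for j
    using norm_mult_power_less_1[OF assms, of j] by auto
  thus ?thesis
    unfolding qpoch_inf_def by (intro prodinf_nonzero convergent_prod_qpoch assms) auto
qed

lemma qpoch_inf_split:
  assumes "norm q < 1"
  shows "qpoch_inf a q = qpoch a q n * qpoch_inf (a * q ^ n) q"
proof -
  have "(\<lambda>m. qpoch a q (n + m)) \<longlonglongrightarrow> qpoch_inf a q"
    using LIMSEQ_ignore_initial_segment[OF qpoch_tendsto[OF assms, of a], of n]
    by (simp add: add.commute)
  moreover have "(\<lambda>m. qpoch a q (n + m)) \<longlonglongrightarrow> qpoch a q n * qpoch_inf (a * q ^ n) q"
    unfolding qpoch_add by (intro tendsto_intros qpoch_tendsto assms)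
  ultimately show ?thesis by (rule LIMSEQ_unique)
qed

lemma qpoch_bounded:
  assumes "norm q < 1"
  obtains K where "K > 0" "\<And>n. norm (qpoch a q n) \<le> K"
  using Bseq_def[of "qpoch a q"] convergent_imp_Bseq[of "qpoch a q"] qpoch_tendsto[OF assms, of a]
  by (auto simp: convergent_def)

lemma inverse_qpoch_bounded:
  assumes "norm q < 1" "norm a < 1"
  obtains K where "K > 0" "\<And>n. norm (1 / qpoch a q n) \<le> K"
proof -
  have "(\<lambda>n. 1 / qpoch a q n) \<longlonglongrightarrow> 1 / qpoch_inf a q"
    by (intro tendsto_intros qpoch_tendsto qpoch_inf_nonzero assms)
  hence "Bseq (\<lambda>n. 1 / qpoch a q n)"
    by (intro convergent_imp_Bseq) (auto simp: convergent_def)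
  thus ?thesis using that by (auto simp: Bseq_def)
qed

section \<open>A limiting case of the q-Gauss sum\<close>

text \<open>
The summand of the $q$-Gauss series ${}_2\phi_1(a, b; bd; q, d/a)$ in the limit $a \to \infty$. The
lower parameter is written as the product $bd$, so that $b = 0$ needs no exception.
\<close>

definition qgauss_term :: "complex \<Rightarrow> complex \<Rightarrow> complex \<Rightarrow> nat \<Rightarrow> complex" where
  "qgauss_term q b d s =
     qpoch b q s * q ^ (s choose 2) * (- d) ^ s / (qpoch q q s * qpoch (b * d) q s)"

lemma qgauss_term_0 [simp]: "qgauss_term q b d 0 = 1"
  by (simp add: qgauss_term_def numeral_2_eq_2)

text \<open>
The bound is uniform in the shift $d \mapsto d q^n$, because
$1/(b d q^n)_s = (bd)_n / (bd)_{n+s}$ has bounded numerator and bounded inverse denominator.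
\<close>

lemma qgauss_term_bound:
  assumes "norm q < 1" "norm d < 1" "norm (b * d) < 1"
  shows "\<exists>C>0. \<forall>s n. norm (qgauss_term q b (d * q ^ n) s) \<le> C * (norm d * norm q ^ n) ^ s"
proof -
  obtain K1 where K1: "K1 > 0" "\<And>n. norm (qpoch b q n) \<le> K1"
    using qpoch_bounded[OF assms(1)] by blast
  obtain K2 where K2: "K2 > 0" "\<And>n. norm (1 / qpoch q q n) \<le> K2"
    using inverse_qpoch_bounded[OF assms(1) assms(1)] by blast
  obtain K3 where K3: "K3 > 0" "\<And>n. norm (qpoch (b * d) q n) \<le> K3"
    using qpoch_bounded[OF assms(1)] by blast
  obtain K4 where K4: "K4 > 0" "\<And>n. norm (1 / qpoch (b * d) q n) \<le> K4"
    using inverse_qpoch_bounded[OF assms(1) assms(3)] by blast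
  have "norm (qgauss_term q b (d * q ^ n) s) \<le> (K1 * K2 * K3 * K4) * (norm d * norm q ^ n) ^ s" for s n
  proof -
    have inv: "1 / qpoch (b * (d * q ^ n)) q s = qpoch (b * d) q n * (1 / qpoch (b * d) q (n + s))"
    proof -
      have "qpoch (b * d) q (n + s) = qpoch (b * d) q n * qpoch (b * (d * q ^ n)) q s"
        using qpoch_add[of "b * d" q n s] by (simp only: mult.assoc)
      thus ?thesis using qpoch_nonzero[OF assms(1,3), of n] by simp
    qed
    have "qgauss_term q b (d * q ^ n) s = qpoch b q s * (1 / qpoch q q s) *
        (1 / qpoch (b * (d * q ^ n)) q s) * q ^ (s choose 2) * (- (d * q ^ n)) ^ s"
      by (simp add: qgauss_term_def)
    also have "\<dots> = qpoch b q s * (1 / qpoch q q s) * qpoch (b * d) q n *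
            (1 / qpoch (b * d) q (n + s)) * q ^ (s choose 2) * (- (d * q ^ n)) ^ s"
      unfolding inv by (simp only: mult.assoc)
    also have "norm \<dots> \<le> K1 * K2 * K3 * K4 * 1 * (norm d * norm q ^ n) ^ s"
      unfolding norm_mult
    proof (intro mult_mono K1(2) K2(2) K3(2) K4(2))
      show "norm (q ^ (s choose 2)) \<le> 1"
        unfolding norm_power using assms by (intro power_le_one) auto
      show "norm ((- (d * q ^ n)) ^ s) \<le> (norm d * norm q ^ n) ^ s"
        by (simp only: norm_power norm_minus_cancel norm_mult)
    qed (use K1(1) K2(1) K3(1) K4(1) in simp_all)
    finally show ?thesis by simp
  qed
  moreover have "K1 * K2 * K3 * K4 > 0" using K1(1) K2(1) K3(1) K4(1) by simp
  ultimately show ?thesis by blast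
qed

lemma summable_norm_qgauss_term:
  assumes "norm q < 1" "norm d < 1" "norm (b * d) < 1"
  shows "summable (\<lambda>s. norm (qgauss_term q b d s))"
proof -
  obtain C where C: "C > 0" "\<And>s n. norm (qgauss_term q b (d * q ^ n) s) \<le> C * (norm d * norm q ^ n) ^ s"
    using qgauss_term_bound[OF assms] by blast
  have "summable (\<lambda>s. C * norm d ^ s)"
    using assms by (intro summable_mult summable_geometric) auto
  thus ?thesis
    by (rule summable_comparison_test'[where N = 0]) (use C(2)[where n = 0] in simp)
qed

text \<open>
The certificate for the contiguous relation $(1 - bd) F(d) = (1 - d) F(dq)$ of the sum $F(d)$: the
difference of the two sides telescopes termwise, with $G_s = (1 - bd)(1 - q^s) t_s(d)$, which
vanishes at $s = 0$ and tends to $0$.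
\<close>

lemma qgauss_term_telescope:
  assumes "norm q < 1" "norm (b * d) < 1"
  shows "(1 - b * d) * qgauss_term q b d s - (1 - d) * qgauss_term q b (d * q) s =
         (1 - b * d) * ((1 - q ^ s) * qgauss_term q b d s - (1 - q ^ Suc s) * qgauss_term q b d (Suc s))"
proof -
  define A where "A = qpoch b q s * q ^ (s choose 2) * (- d) ^ s"
  define P where "P = qpoch q q s"
  define R where "R = qpoch (b * d) q s"
  define y where "y = q ^ s"
  have nz: "P \<noteq> 0" "R \<noteq> 0" "1 - b * d * y \<noteq> 0" "1 - b * d \<noteq> 0" "1 - q * y \<noteq> 0"
    using qpoch_nonzero[OF assms(1,1)] qpoch_nonzero[OF assms]
          norm_mult_power_less_1[OF assms, of s] assms norm_mult_power_less_1[OF assms(1,1), of s]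
    by (auto simp: P_def R_def y_def)
  have e1: "qgauss_term q b d s = A / (P * R)"
    by (simp add: qgauss_term_def A_def P_def R_def)
  have "qpoch (b * d) q (Suc s) = (1 - b * d) * qpoch (b * (d * q)) q s"
    using qpoch_Suc_left[of "b * d" q s] by (simp add: mult_ac)
  hence "qpoch (b * (d * q)) q s = R * (1 - b * d * y) / (1 - b * d)"
    using nz by (simp add: qpoch_Suc R_def y_def field_simps)
  moreover have "(- (d * q)) ^ s = (- d) ^ s * y"
    by (metis mult_minus_left power_mult_distrib y_def)
  ultimately have "qgauss_term q b (d * q) s =
      qpoch b q s * q ^ (s choose 2) * ((- d) ^ s * y) / (P * (R * (1 - b * d * y) / (1 - b * d)))"
    by (simp only: qgauss_term_def P_def)
  hence e2: "qgauss_term q b (d * q) s = A * y * (1 - b * d) / (P * R * (1 - b * d * y))"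
    by (simp add: A_def mult.assoc)
  have "q ^ (Suc s choose 2) = q ^ (s choose 2) * y"
    by (simp add: numeral_2_eq_2 power_add y_def)
  hence e3: "qgauss_term q b d (Suc s) =
      A * (1 - b * y) * y * (- d) / (P * (1 - q * y) * (R * (1 - b * d * y)))"
    by (simp add: qgauss_term_def A_def P_def R_def qpoch_Suc y_def mult_ac)
  define Z where "Z = A / (P * R * (1 - b * d * y))"
  have f1: "qgauss_term q b d s = Z * (1 - b * d * y)"
    unfolding e1 Z_def using nz(3) by simp
  have f2: "qgauss_term q b (d * q) s = Z * y * (1 - b * d)"
    unfolding e2 Z_def by simp
  have f3: "(1 - q * y) * qgauss_term q b d (Suc s) = Z * (1 - b * y) * y * (- d)"
    unfolding e3 Z_def using nz(5) by (simp add: mult.assoc)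
  show ?thesis
    unfolding power_Suc y_def[symmetric] f1 f2 f3 by (simp add: algebra_simps)
qed

lemma qgauss_contiguous:
  assumes "norm q < 1" "norm d < 1" "norm (b * d) < 1"
  shows "(1 - b * d) * (\<Sum>s. qgauss_term q b d s) = (1 - d) * (\<Sum>s. qgauss_term q b (d * q) s)"
proof -
  have dq: "norm (d * q) < 1" "norm (b * (d * q)) < 1"
    using norm_mult_power_less_1[OF assms(1,2), of 1] norm_mult_power_less_1[OF assms(1,3), of 1]
    by (simp_all add: mult_ac)
  define G where "G = (\<lambda>s. (1 - q ^ s) * qgauss_term q b d s)"
  have sm: "summable (\<lambda>s. qgauss_term q b d s)" "summable (\<lambda>s. qgauss_term q b (d * q) s)"
    using summable_norm_qgauss_term[OF assms] summable_norm_qgauss_term[OF assms(1) dq]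
    by (auto intro: summable_norm_cancel)
  have "(\<lambda>s. q ^ s) \<longlonglongrightarrow> 0" by (rule LIMSEQ_power_zero[OF assms(1)])
  hence "G \<longlonglongrightarrow> (1 - 0) * 0"
    unfolding G_def by (intro tendsto_intros summable_LIMSEQ_zero sm assms)
  hence "(\<lambda>s. G s - G (Suc s)) sums (G 0 - 0)"
    by (intro telescope_sums') simp
  hence "(\<lambda>s. (1 - b * d) * (G s - G (Suc s))) sums 0"
    using sums_mult by (fastforce simp: G_def)
  hence "(\<lambda>s. (1 - b * d) * qgauss_term q b d s - (1 - d) * qgauss_term q b (d * q) s) sums 0"
    by (simp only: qgauss_term_telescope[OF assms(1,3)] G_def)
  moreover have "(\<lambda>s. (1 - b * d) * qgauss_term q b d s - (1 - d) * qgauss_term q b (d * q) s) sums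
    ((1 - b * d) * (\<Sum>s. qgauss_term q b d s) - (1 - d) * (\<Sum>s. qgauss_term q b (d * q) s))"
    by (intro sums_diff sums_mult summable_sums sm)
  ultimately show ?thesis using sums_unique2 by fastforce
qed

text \<open>
Iterating the contiguous relation gives $(bd)_n F(d) = (d)_n F(d q^n)$, and $F(d q^n) \to 1$.
\<close>

lemma qgauss_limit_sums:
  assumes "norm q < 1" "norm d < 1" "norm (b * d) < 1"
  shows "qgauss_term q b d sums (qpoch_inf d q / qpoch_inf (b * d) q)"
proof -
  define F where "F = (\<lambda>d. \<Sum>s. qgauss_term q b d s)"
  have dq: "norm (d * q ^ n) < 1" "norm (b * (d * q ^ n)) < 1" for n
    using norm_mult_power_less_1[OF assms(1,2), of n] norm_mult_power_less_1[OF assms(1,3), of n]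
    by (simp_all add: mult_ac)
  have iter: "qpoch (b * d) q n * F d = qpoch d q n * F (d * q ^ n)" for n
  proof (induction n)
    case (Suc n)
    have "qpoch (b * d) q (Suc n) * F d = (1 - b * d * q ^ n) * (qpoch d q n * F (d * q ^ n))"
      by (simp add: qpoch_Suc flip: Suc.IH)
    also have "\<dots> = qpoch d q n * ((1 - b * (d * q ^ n)) * F (d * q ^ n))"
      by (simp add: mult_ac)
    also have "(1 - b * (d * q ^ n)) * F (d * q ^ n) = (1 - d * q ^ n) * F (d * q ^ Suc n)"
      unfolding F_def qgauss_contiguous[OF assms(1) dq] by (simp add: mult_ac)
    finally show ?case by (simp add: qpoch_Suc mult_ac)
  qed simp
  obtain C where C: "C > 0" "\<And>s n. norm (qgauss_term q b (d * q ^ n) s) \<le> C * (norm d * norm q ^ n) ^ s"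
    using qgauss_term_bound[OF assms] by blast
  have bound: "norm (F (d * q ^ n) - 1) \<le> norm q ^ n * (C * (\<Sum>s. norm d ^ s))" for n
  proof -
    have sm: "summable (\<lambda>s. norm (qgauss_term q b (d * q ^ n) s))"
      using summable_norm_qgauss_term[OF assms(1) dq] .
    have smS: "summable (\<lambda>s. norm (qgauss_term q b (d * q ^ n) (Suc s)))"
      using summable_Suc_iff[of "\<lambda>s. norm (qgauss_term q b (d * q ^ n) s)"] sm by blast
    have sg: "summable (\<lambda>s. norm d ^ s)" using assms by (intro summable_geometric) auto
    have "F (d * q ^ n) - 1 = (\<Sum>s. qgauss_term q b (d * q ^ n) (Suc s))"
      unfolding F_def using suminf_split_head[OF summable_norm_cancel[OF sm]] by simp
    also have "norm \<dots> \<le> (\<Sum>s. norm (qgauss_term q b (d * q ^ n) (Suc s)))"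
      by (intro summable_norm smS)
    also have "\<dots> \<le> (\<Sum>s. norm q ^ n * C * norm d ^ s)"
    proof (rule suminf_le)
      fix s
      have "norm (qgauss_term q b (d * q ^ n) (Suc s)) \<le> C * (norm d * norm q ^ n) ^ Suc s"
        by (rule C)
      also have "\<dots> = norm q ^ n * C * norm d ^ s * (norm d * (norm q ^ n) ^ s)"
        by (simp add: power_mult_distrib mult_ac)
      also have "\<dots> \<le> norm q ^ n * C * norm d ^ s * (1 * 1)"
        using assms C(1)
        by (intro mult_left_mono mult_mono power_le_one mult_nonneg_nonneg zero_le_power norm_ge_zero) auto
      finally show "norm (qgauss_term q b (d * q ^ n) (Suc s)) \<le> norm q ^ n * C * norm d ^ s" by simp
    next
      show "summable (\<lambda>s. norm (qgauss_term q b (d * q ^ n) (Suc s)))"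
        by (rule smS)
      show "summable (\<lambda>s. norm q ^ n * C * norm d ^ s)" by (intro summable_mult sg)
    qed
    also have "\<dots> = norm q ^ n * (C * (\<Sum>s. norm d ^ s))"
      using suminf_mult[OF sg, of "norm q ^ n * C"] by (simp add: mult_ac)
    finally show ?thesis .
  qed
  have "(\<lambda>n. norm q ^ n * (C * (\<Sum>s. norm d ^ s))) \<longlonglongrightarrow> 0 * (C * (\<Sum>s. norm d ^ s))"
    using assms by (intro tendsto_intros LIMSEQ_power_zero) auto
  hence "(\<lambda>n. norm q ^ n * (C * (\<Sum>s. norm d ^ s))) \<longlonglongrightarrow> 0" by simp
  hence "(\<lambda>n. F (d * q ^ n) - 1) \<longlonglongrightarrow> 0"
    by (rule Lim_null_comparison[rotated]) (intro always_eventually allI bound)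
  hence "(\<lambda>n. F (d * q ^ n)) \<longlonglongrightarrow> 1" by (simp add: LIM_zero_iff)
  hence "(\<lambda>n. qpoch d q n * F (d * q ^ n)) \<longlonglongrightarrow> qpoch_inf d q * 1"
    by (intro tendsto_mult qpoch_tendsto assms)
  moreover have "(\<lambda>n. qpoch (b * d) q n * F d) \<longlonglongrightarrow> qpoch_inf (b * d) q * F d"
    by (intro tendsto_intros qpoch_tendsto assms)
  moreover have "(\<lambda>n. qpoch (b * d) q n * F d) = (\<lambda>n. qpoch d q n * F (d * q ^ n))"
    by (rule ext) (rule iter)
  ultimately have "qpoch_inf (b * d) q * F d = qpoch_inf d q * 1"
    using LIMSEQ_unique by metis
  hence "F d = qpoch_inf d q / qpoch_inf (b * d) q"
    using qpoch_inf_nonzero[OF assms(1,3)] by (simp add: field_simps)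
  thus ?thesis
    unfolding F_def
    using summable_sums[OF summable_norm_cancel[OF summable_norm_qgauss_term[OF assms]]] by simp
qed

section \<open>The terminating case\<close>

text \<open>
$(q^{-N})_s = (-1)^s q^{s(s-1)/2 - Ns} (q)_N / (q)_{N-s}$, without the division.
\<close>

lemma qpoch_inverse_power:
  assumes "q \<noteq> 0" "s \<le> N"
  shows "qpoch (inverse (q ^ N)) q s * q ^ (s choose 2) * (- (q ^ N)) ^ s * qpoch q q (N - s)
         = q ^ (s * (s - 1)) * qpoch q q N"
  using assms(2)
proof (induction s)
  case (Suc s)
  have N: "N - s = Suc (N - Suc s)" using Suc.prems by simp
  have P: "qpoch q q (N - s) = qpoch q q (N - Suc s) * (1 - q ^ (N - s))"
    unfolding N qpoch_Suc by simp
  have qN: "q ^ N = q ^ s * q ^ (N - s)" using Suc.prems by (simp flip: power_add)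
  have E: "(1 - inverse (q ^ N) * q ^ s) * (- (q ^ N)) = q ^ s * (1 - q ^ (N - s))"
    using assms by (simp add: field_simps qN)
  have C: "q ^ (Suc s choose 2) = q ^ (s choose 2) * q ^ s"
    by (simp add: numeral_2_eq_2 power_add)
  have "qpoch (inverse (q ^ N)) q (Suc s) * q ^ (Suc s choose 2) * (- (q ^ N)) ^ Suc s * qpoch q q (N - Suc s)
     = (qpoch (inverse (q ^ N)) q s * q ^ (s choose 2) * (- (q ^ N)) ^ s * qpoch q q (N - Suc s))
        * ((1 - inverse (q ^ N) * q ^ s) * (- (q ^ N))) * q ^ s"
    by (simp only: qpoch_Suc C power_Suc mult_ac)
  also have "\<dots> = (qpoch (inverse (q ^ N)) q s * q ^ (s choose 2) * (- (q ^ N)) ^ s * qpoch q q (N - s))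
        * (q ^ s * q ^ s)"
    unfolding E P by (simp only: mult_ac)
  also have "\<dots> = q ^ (s * (s - 1)) * (q ^ s * q ^ s) * qpoch q q N"
    using Suc.IH Suc.prems by (simp add: mult_ac)
  also have "q ^ (s * (s - 1)) * (q ^ s * q ^ s) = q ^ (Suc s * (Suc s - 1))"
    unfolding power_add[symmetric] by (rule arg_cong[where f = "power q"]) (cases s, simp_all)
  finally show ?case .
qed (simp add: numeral_2_eq_2)

lemma qpoch_inverse_power_eq_0:
  assumes "q \<noteq> 0" "s > N"
  shows "qpoch (inverse (q ^ N)) q s = 0"
  using assms by (auto simp: qpoch_conv_lessThan intro!: bexI[of _ N])

text \<open>
A form of the $q$-Vandermonde sum, obtained with $b = q^{-N}$ and $d = q^{N+c+1}$.
\<close>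

lemma q_vandermonde:
  fixes c N :: nat
  assumes "norm q < 1" "q \<noteq> 0"
  shows "(\<Sum>s\<le>N. q ^ (s * s + c * s) / (qpoch q q (N - s) * qpoch q q s * qpoch q q (s + c)))
         = 1 / (qpoch q q N * qpoch q q (N + c))"
proof -
  define b where "b = inverse (q ^ N)"
  define d where "d = q ^ (N + c + 1)"
  have bd: "b * d = q * q ^ c" using assms by (simp add: b_def d_def power_add)
  have nd: "norm d < 1" "norm (b * d) < 1" "norm (q * q ^ c) < 1"
    using norm_mult_power_less_1[OF assms(1,1)] unfolding bd by (simp_all add: d_def)
  note nz = qpoch_nonzero[OF assms(1,1)] qpoch_nonzero[OF assms(1) nd(3)]
  have term_eq: "qgauss_term q b d s = qpoch q q N * qpoch q q c *
      (q ^ (s * s + c * s) / (qpoch q q (N - s) * qpoch q q s * qpoch q q (s + c)))"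
    if "s \<le> N" for s
  proof -
    have dpow: "(- d) ^ s = (- (q ^ N)) ^ s * q ^ ((c + 1) * s)"
    proof -
      have "- d = - (q ^ N) * q ^ (c + 1)" by (simp add: d_def power_add)
      thus ?thesis by (simp only: power_mult_distrib power_mult)
    qed
    have "qpoch b q s * q ^ (s choose 2) * (- d) ^ s * qpoch q q (N - s)
        = q ^ (s * (s - 1)) * qpoch q q N * q ^ ((c + 1) * s)"
      unfolding qpoch_inverse_power[OF assms(2) that, symmetric] b_def dpow by (simp only: mult_ac)
    also have "\<dots> = qpoch q q N * q ^ (s * s + c * s)"
      by (cases s) (simp_all add: power_add algebra_simps)
    finally have "qpoch b q s * q ^ (s choose 2) * (- d) ^ s =
        qpoch q q N * q ^ (s * s + c * s) / qpoch q q (N - s)"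
      using nz by (simp add: field_simps)
    moreover have "qpoch (b * d) q s = qpoch q q (s + c) / qpoch q q c"
      using qpoch_add[of q q c s] nz by (simp add: bd add.commute)
    ultimately show ?thesis
      using nz by (simp add: qgauss_term_def mult_ac)
  qed
  have "qgauss_term q b d s = 0" if "s \<notin> {..N}" for s
    using that qpoch_inverse_power_eq_0[OF assms(2), of N s] by (simp add: qgauss_term_def b_def)
  hence "qgauss_term q b d sums (\<Sum>s\<le>N. qgauss_term q b d s)"
    by (intro sums_finite) auto
  hence "(\<Sum>s\<le>N. qgauss_term q b d s) = qpoch_inf d q / qpoch_inf (b * d) q"
    using qgauss_limit_sums[OF assms(1) nd(1,2)] sums_unique2 by blast
  moreover have "qpoch_inf (b * d) q = qpoch (q * q ^ c) q N * qpoch_inf d q"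
    unfolding bd using qpoch_inf_split[OF assms(1), of "q * q ^ c" N]
    by (simp add: d_def power_add mult_ac)
  moreover have "qpoch (q * q ^ c) q N = qpoch q q (N + c) / qpoch q q c"
    using qpoch_add[of q q c N] nz by (simp add: add.commute)
  ultimately have "(\<Sum>s\<le>N. qgauss_term q b d s) = qpoch q q c / qpoch q q (N + c)"
    using qpoch_inf_nonzero[OF assms(1) nd(1)] by simp
  moreover have "(\<Sum>s\<le>N. qgauss_term q b d s) = qpoch q q N * qpoch q q c *
     (\<Sum>s\<le>N. q ^ (s * s + c * s) / (qpoch q q (N - s) * qpoch q q s * qpoch q q (s + c)))"
    unfolding sum_distrib_left by (intro sum.cong) (auto simp: term_eq)
  ultimately show ?thesis using nz by (simp add: field_simps)
qed

section \<open>Powers of the nome\<close>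

text \<open>
The locale only fixes a point $\tau$ of the upper half-plane, so that $q = e^{2 \pi i \tau}$ and its
real powers \<open>qpow \<tau> a\<close> can be used without repeating the hypothesis.
\<close>

locale nome =
  fixes \<tau> :: complex
  assumes Im_pos: "Im \<tau> > 0"
begin

abbreviation q :: complex where "q \<equiv> qpow \<tau> 1"

lemma qpow_0 [simp]: "qpow \<tau> 0 = 1"
  by (simp add: qpow_def)

lemma qpow_nonzero [simp]: "qpow \<tau> a \<noteq> 0"
  by (simp add: qpow_def)

lemma qpow_add: "qpow \<tau> (a + b) = qpow \<tau> a * qpow \<tau> b"
  by (simp add: qpow_def ring_distribs exp_add)

lemma qpow_of_nat: "qpow \<tau> (real n) = q ^ n"
proof (induction n)
  case (Suc n)
  have "qpow \<tau> (real (Suc n)) = qpow \<tau> (1 + real n)" by simp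
  thus ?case unfolding qpow_add by (simp add: Suc)
qed simp

lemma qpow_mult_of_nat: "qpow \<tau> (a * real n) = qpow \<tau> a ^ n"
proof (induction n)
  case (Suc n)
  have "qpow \<tau> (a * real (Suc n)) = qpow \<tau> (a + a * real n)" by (simp add: algebra_simps)
  thus ?case unfolding qpow_add by (simp add: Suc)
qed simp

lemma norm_qpow: "norm (qpow \<tau> a) = exp (- (2 * pi * a * Im \<tau>))"
  by (simp add: qpow_def norm_exp_eq_Re)

lemma norm_qpow_antimono: "a \<le> b \<Longrightarrow> norm (qpow \<tau> b) \<le> norm (qpow \<tau> a)"
  using Im_pos by (simp add: norm_qpow)

lemma norm_qpow_less_1: "a > 0 \<Longrightarrow> norm (qpow \<tau> a) < 1"
  using Im_pos by (simp add: norm_qpow)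

lemma norm_q: "norm q < 1"
  by (rule norm_qpow_less_1) simp

lemmas qq_nonzero [simp] = qpoch_nonzero[OF norm_q norm_q]

lemma inv_qfact_of_nat: "inv_qfact q (int n) = 1 / qpoch q q n"
  by (simp add: inv_qfact_def)

lemma inv_qfact_neg [simp]: "m < 0 \<Longrightarrow> inv_qfact q m = 0"
  by (simp add: inv_qfact_def)

lemma inv_qfact_diff_1: "inv_qfact q (m - 1) = (1 - qpow \<tau> (of_int m)) * inv_qfact q m"
proof (cases "m \<ge> 1")
  case True
  define n where "n = nat (m - 1)"
  have n: "m = int (Suc n)" using True by (simp add: n_def)
  have "1 - q ^ Suc n \<noteq> 0"
    using norm_mult_power_less_1[OF norm_q norm_q, of n] by auto
  moreover have "m - 1 = int n" "qpow \<tau> (of_int m) = q ^ Suc n"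
    unfolding n of_int_of_nat_eq qpow_of_nat by simp_all
  ultimately show ?thesis
    unfolding n by (simp only: inv_qfact_of_nat qpoch_Suc) (simp add: field_simps)
next
  case False
  hence "m = 0 \<or> m < 0" by auto
  thus ?thesis by auto
qed

lemma inv_qfact_bounded: obtains K where "K > 0" "\<And>m. norm (inv_qfact q m) \<le> K"
proof -
  obtain K where K: "K > 0" "\<And>n. norm (1 / qpoch q q n) \<le> K"
    using inverse_qpoch_bounded[OF norm_q norm_q] by blast
  have "norm (inv_qfact q m) \<le> K" for m
    using K(2)[of "nat m"] K(1) by (simp add: inv_qfact_def)
  with K(1) show ?thesis by (rule that)
qed

section \<open>The Bailey kernel\<close>

text \<open>
$B_c(r, M) = 1/(q)_{M-r} (q)_{M+r+c}$, the kernel of the Bailey transform with parameter $a = q^c$ up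
to the constant $(q)_c$. Only $c = 0$ and $c = 1$ occur later. The argument $M$ is an integer, and the
kernel vanishes for $M < r$ by the convention on $1/(q)_m$.
\<close>

definition bailey_kernel :: "nat \<Rightarrow> nat \<Rightarrow> int \<Rightarrow> complex" where
  "bailey_kernel c r M = inv_qfact q (M - int r) * inv_qfact q (M + int r + int c)"

lemma bailey_kernel_eq_0: "M < int r \<Longrightarrow> bailey_kernel c r M = 0"
  by (simp add: bailey_kernel_def)

lemma bailey_kernel_add:
  "bailey_kernel c r (int (r + s)) = 1 / (qpoch q q s * qpoch q q (s + (2 * r + c)))"
proof -
  have "int (r + s) - int r = int s" "int (r + s) + int r + int c = int (s + (2 * r + c))"
    by simp_all
  thus ?thesis unfolding bailey_kernel_def by (simp only: inv_qfact_of_nat) simp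
qed

lemma bailey_kernel_1:
  "(1 - qpow \<tau> (2 * real r + 1)) * bailey_kernel 1 r M =
     bailey_kernel 0 r M - qpow \<tau> (2 * real r + 1) * bailey_kernel 0 (Suc r) M"
proof -
  define x where "x = qpow \<tau> (2 * real r + 1)"
  define y where "y = qpow \<tau> (of_int (M - int r))"
  have 1: "inv_qfact q (M + int r) = (1 - x * y) * inv_qfact q (M + int r + 1)"
    using inv_qfact_diff_1[of "M + int r + 1"]
    by (simp add: x_def y_def add_ac flip: qpow_add)
  have 2: "inv_qfact q (M - int (Suc r)) = (1 - y) * inv_qfact q (M - int r)"
    using inv_qfact_diff_1[of "M - int r"] by (simp add: y_def algebra_simps)
  have 3: "M + int r + int 0 = M + int r" "M + int (Suc r) + int 0 = M + int r + 1"
    "M + int r + int 1 = M + int r + 1" by simp_all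
  show ?thesis
    unfolding bailey_kernel_def x_def[symmetric] 3 1 2 by (simp only: algebra_simps mult_1)
qed

text \<open>
One step of the Bailey chain, on a single kernel. With $m = r + s$ and $N = M - r$ it is the
$q$-Vandermonde sum with $2r + c$ in place of $c$.
\<close>

lemma sum_bailey_kernel:
  "(\<Sum>m\<in>{int r..M}. qpow \<tau> ((of_int m)\<^sup>2 + real c * of_int m) * bailey_kernel c r m * inv_qfact q (M - m))
   = qpow \<tau> ((real r)\<^sup>2 + real c * real r) * bailey_kernel c r M"
proof (cases "M < int r")
  case True
  thus ?thesis by (simp add: bailey_kernel_eq_0)
next
  case False
  define N where "N = nat (M - int r)"
  have M: "M = int (r + N)" using False by (simp add: N_def)
  define E where "E = qpow \<tau> ((real r)\<^sup>2 + real c * real r)"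
  define c' where "c' = 2 * r + c"
  have "(\<Sum>m\<in>{int r..M}. qpow \<tau> ((of_int m)\<^sup>2 + real c * of_int m) * bailey_kernel c r m * inv_qfact q (M - m))
      = (\<Sum>s\<le>N. E * (q ^ (s * s + c' * s) / (qpoch q q (N - s) * qpoch q q s * qpoch q q (s + c'))))"
  proof (rule sum.reindex_bij_witness[of _ "\<lambda>s. int (r + s)" "\<lambda>m. nat (m - int r)"])
    fix m assume m: "m \<in> {int r..M}"
    define s where "s = nat (m - int r)"
    have ms: "m = int (r + s)" and sN: "s \<le> N" using m by (auto simp: s_def N_def)
    have "(of_int m)\<^sup>2 + real c * of_int m = ((real r)\<^sup>2 + real c * real r) + real (s * s + c' * s)"
      unfolding ms c'_def by (simp add: power2_eq_square algebra_simps)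
    hence "qpow \<tau> ((of_int m)\<^sup>2 + real c * of_int m) = E * q ^ (s * s + c' * s)"
      by (simp only: qpow_add qpow_of_nat E_def)
    moreover have "M - m = int (N - s)" using sN by (simp add: M ms)
    ultimately show "E * (q ^ (s * s + c' * s) / (qpoch q q (N - s) * qpoch q q s * qpoch q q (s + c')))
       = qpow \<tau> ((of_int m)\<^sup>2 + real c * of_int m) * bailey_kernel c r m * inv_qfact q (M - m)"
      by (simp only: inv_qfact_of_nat ms bailey_kernel_add c'_def[symmetric]) simp
  qed (auto simp: M)
  also have "\<dots> = E * (1 / (qpoch q q N * qpoch q q (N + c')))"
    unfolding sum_distrib_left[symmetric] by (subst q_vandermonde) (simp_all add: norm_q)
  also have "\<dots> = E * bailey_kernel c r M"
    unfolding M bailey_kernel_add c'_def ..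
  finally show ?thesis by (simp only: E_def)
qed

text \<open>
The last step of the chain: the $q$-Gauss limit with $b = -q^{r+1/2}$ and $d = -q^{r+1/2+c}$, so that
$bd = q^{2r+c+1}$.
\<close>

lemma sums_bailey_kernel:
  defines "f \<equiv> \<lambda>c r s. qpow \<tau> ((real (r + s))\<^sup>2 / 2 + real c * real (r + s)) *
             qpoch (- qpow \<tau> (1/2)) q (r + s) * bailey_kernel c r (int (r + s))"
  shows "summable (\<lambda>s. norm (f c r s))"
    and "f c r sums (qpow \<tau> ((real r)\<^sup>2 / 2 + real c * real r) * qpoch (- qpow \<tau> (1/2)) q r *
           qpoch_inf (- qpow \<tau> (real r + 1/2 + real c)) q / qpoch_inf q q)"
proof -
  define b where "b = - qpow \<tau> (real r + 1/2)"
  define d where "d = - qpow \<tau> (real r + 1/2 + real c)"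
  define E where "E = qpow \<tau> ((real r)\<^sup>2 / 2 + real c * real r) * qpoch (- qpow \<tau> (1/2)) q r"
  define Q where "Q = qpoch q q (2 * r + c)"
  have Q: "Q \<noteq> 0" by (simp add: Q_def)
  have bd: "b * d = q * q ^ (2 * r + c)"
  proof -
    have "b * d = qpow \<tau> (1 + real (2 * r + c))"
      unfolding b_def d_def by (simp add: add_ac flip: qpow_add)
    thus ?thesis by (simp only: qpow_add qpow_of_nat)
  qed
  have nd: "norm d < 1" "norm (b * d) < 1"
    unfolding bd by (auto simp: d_def intro: norm_qpow_less_1 norm_mult_power_less_1[OF norm_q norm_q])
  have eq: "f c r s = E / Q * qgauss_term q b d s" for s
  proof -
    have 1: "(real (r + s))\<^sup>2 / 2 + real c * real (r + s) =
        ((real r)\<^sup>2 / 2 + real c * real r) + (real (s choose 2) + (real r + 1/2 + real c) * real s)"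
    proof -
      have "real (s choose 2) = real s * (real s - 1) / 2"
        by (induction s) (simp_all add: numeral_2_eq_2 field_simps)
      thus ?thesis by (simp add: power2_eq_square field_simps)
    qed
    have 2: "qpow \<tau> ((real (r + s))\<^sup>2 / 2 + real c * real (r + s)) =
        qpow \<tau> ((real r)\<^sup>2 / 2 + real c * real r) * (q ^ (s choose 2) * (- d) ^ s)"
      unfolding 1 qpow_add[of "(real r)\<^sup>2 / 2 + real c * real r"] qpow_add[of "real (s choose 2)"]
        qpow_of_nat qpow_mult_of_nat d_def by simp
    have 3: "- qpow \<tau> (1/2) * q ^ r = b"
      unfolding b_def qpow_of_nat[symmetric] by (simp flip: qpow_add add: add.commute)
    have 4: "qpoch q q (s + (2 * r + c)) = Q * qpoch (b * d) q s"
      unfolding bd Q_def by (subst add.commute) (rule qpoch_add)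
    show ?thesis
      unfolding f_def 2 qpoch_add[of _ _ r s] 3 bailey_kernel_add 4
      by (simp add: E_def qgauss_term_def mult_ac)
  qed
  show "summable (\<lambda>s. norm (f c r s))"
    unfolding eq norm_mult by (intro summable_mult summable_norm_qgauss_term norm_q nd)
  have "f c r sums (E / Q * (qpoch_inf d q / qpoch_inf (b * d) q))"
    unfolding eq by (intro sums_mult qgauss_limit_sums norm_q nd)
  moreover have "qpoch_inf q q = Q * qpoch_inf (b * d) q"
    unfolding bd Q_def by (rule qpoch_inf_split[OF norm_q])
  ultimately show "f c r sums (qpow \<tau> ((real r)\<^sup>2 / 2 + real c * real r) * qpoch (- qpow \<tau> (1/2)) q r *
           qpoch_inf (- qpow \<tau> (real r + 1/2 + real c)) q / qpoch_inf q q)"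
    using Q by (simp add: E_def d_def)
qed

section \<open>Bailey pairs\<close>

text \<open>
$(a, \beta)$ is a Bailey pair with parameter $q^c$ whose first sequence is supported on $r \ge L$. The
sequence \<open>\<beta>\<close> is defined on all integers. The upper limit may be replaced by any larger one
(\<open>bailey_pair_extend\<close>).
\<close>

definition bailey_pair :: "nat \<Rightarrow> nat \<Rightarrow> (nat \<Rightarrow> complex) \<Rightarrow> (int \<Rightarrow> complex) \<Rightarrow> bool" where
  "bailey_pair L c a \<beta> \<longleftrightarrow> (\<forall>M. \<beta> M = (\<Sum>r=L..nat M. a r * bailey_kernel c r M))"

lemma bailey_pair_extend:
  assumes "bailey_pair L c a \<beta>" "nat M \<le> R"
  shows "\<beta> M = (\<Sum>r=L..R. a r * bailey_kernel c r M)"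
proof -
  have "\<beta> M = (\<Sum>r=L..nat M. a r * bailey_kernel c r M)"
    using assms by (simp add: bailey_pair_def)
  also have "\<dots> = (\<Sum>r=L..R. a r * bailey_kernel c r M)"
    using assms by (intro sum.mono_neutral_left) (auto simp: bailey_kernel_eq_0)
  finally show ?thesis .
qed

text \<open>
Bailey's lemma with both of its free parameters at infinity. The constant $e$ normalises the powers,
and the lower limit $l$ is the value of $M$ at which the summation variables of the multisum vanish;
it may lie below the support.
\<close>

lemma bailey_lemma:
  assumes "bailey_pair L c a \<beta>" "l \<le> int L"
  shows "bailey_pair L c (\<lambda>r. a r * qpow \<tau> ((real r)\<^sup>2 + real c * real r - e))
           (\<lambda>M. \<Sum>m\<in>{l..M}. qpow \<tau> ((of_int m)\<^sup>2 + real c * of_int m - e) * \<beta> m * inv_qfact q (M - m))"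
  unfolding bailey_pair_def
proof
  fix M
  have qe: "qpow \<tau> (x - e) = qpow \<tau> (- e) * qpow \<tau> x" for x
    by (simp flip: qpow_add)
  let ?g = "\<lambda>r m. qpow \<tau> ((of_int m)\<^sup>2 + real c * of_int m) * bailey_kernel c r m * inv_qfact q (M - m)"
  have "(\<Sum>m\<in>{l..M}. qpow \<tau> ((of_int m)\<^sup>2 + real c * of_int m - e) * \<beta> m * inv_qfact q (M - m))
      = (\<Sum>m\<in>{l..M}. \<Sum>r=L..nat M. qpow \<tau> (- e) * a r * ?g r m)"
  proof (rule sum.cong[OF refl])
    fix m assume "m \<in> {l..M}"
    hence "nat m \<le> nat M" by auto
    from bailey_pair_extend[OF assms(1) this]
    show "qpow \<tau> ((of_int m)\<^sup>2 + real c * of_int m - e) * \<beta> m * inv_qfact q (M - m)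
        = (\<Sum>r=L..nat M. qpow \<tau> (- e) * a r * ?g r m)"
      unfolding qe by (simp add: sum_distrib_left sum_distrib_right mult_ac)
  qed
  also have "\<dots> = (\<Sum>r=L..nat M. qpow \<tau> (- e) * a r * (\<Sum>m\<in>{l..M}. ?g r m))"
    by (subst sum.swap) (simp add: sum_distrib_left)
  also have "\<dots> = (\<Sum>r=L..nat M. qpow \<tau> (- e) * a r * (\<Sum>m\<in>{int r..M}. ?g r m))"
  proof (rule sum.cong[OF refl])
    fix r assume "r \<in> {L..nat M}"
    hence "(\<Sum>m\<in>{l..M}. ?g r m) = (\<Sum>m\<in>{int r..M}. ?g r m)"
      using assms(2) by (intro sum.mono_neutral_right) (auto simp: bailey_kernel_eq_0)
    thus "qpow \<tau> (- e) * a r * (\<Sum>m\<in>{l..M}. ?g r m) = qpow \<tau> (- e) * a r * (\<Sum>m\<in>{int r..M}. ?g r m)"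
      by (rule arg_cong)
  qed
  also have "\<dots> = (\<Sum>r=L..nat M. a r * qpow \<tau> ((real r)\<^sup>2 + real c * real r - e) * bailey_kernel c r M)"
    unfolding sum_bailey_kernel qe by (simp add: mult_ac)
  finally show "(\<Sum>m\<in>{l..M}. qpow \<tau> ((of_int m)\<^sup>2 + real c * of_int m - e) * \<beta> m * inv_qfact q (M - m)) = \<dots>" .
qed

lemma sum_bailey_kernel_1_telescope:
  assumes "L \<le> R"
  shows "(\<Sum>r=L..R. \<alpha> r * (1 - qpow \<tau> (2 * real r + 1)) * bailey_kernel 1 r M) =
         (\<Sum>r=L..R. (\<alpha> r - (if r > L then qpow \<tau> (2 * real r - 1) * \<alpha> (r - 1) else 0)) * bailey_kernel 0 r M)
         - \<alpha> R * qpow \<tau> (2 * real R + 1) * bailey_kernel 0 (Suc R) M"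
proof -
  let ?t = "\<lambda>r. qpow \<tau> (2 * real r + 1)"
  have key: "\<alpha> r * (1 - ?t r) * bailey_kernel 1 r M =
      \<alpha> r * bailey_kernel 0 r M - \<alpha> r * ?t r * bailey_kernel 0 (Suc r) M" for r
    unfolding mult.assoc[of "\<alpha> r"] bailey_kernel_1 by (simp only: right_diff_distrib)
  from assms show ?thesis
    unfolding key
  proof (induction R rule: dec_induct)
    case base
    show ?case by simp
  next
    case (step R)
    have t: "qpow \<tau> (2 * real (Suc R) - 1) = ?t R" by (simp add: algebra_simps)
    have "{L..Suc R} = insert (Suc R) {L..R}" "Suc R > L" using step.hyps by auto
    thus ?case using step.IH by (simp add: t algebra_simps)
  qed
qed

text \<open>
The change of parameter from $q$ to $1$.
\<close>

lemma bailey_pair_1_imp_0: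
  assumes "bailey_pair L 1 (\<lambda>r. \<alpha> r * (1 - qpow \<tau> (2 * real r + 1))) \<beta>"
  shows "bailey_pair L 0 (\<lambda>r. \<alpha> r - (if r > L then qpow \<tau> (2 * real r - 1) * \<alpha> (r - 1) else 0)) \<beta>"
  unfolding bailey_pair_def
proof
  fix M
  show "\<beta> M = (\<Sum>r=L..nat M. (\<alpha> r - (if r > L then qpow \<tau> (2 * real r - 1) * \<alpha> (r - 1) else 0)) * bailey_kernel 0 r M)"
  proof (cases "L \<le> nat M")
    case True
    have "bailey_kernel 0 (Suc (nat M)) M = 0" by (simp add: bailey_kernel_eq_0)
    with assms sum_bailey_kernel_1_telescope[OF True, of \<alpha> M] show ?thesis
      by (simp add: bailey_pair_def)
  next
    case False
    with assms show ?thesis by (simp add: bailey_pair_def)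
  qed
qed

text \<open>
The starting point: $B_0(L, \cdot)$ is itself the second member of a Bailey pair with parameter $q$.
For $\alpha_r = q^{r^2 - L^2}$ one has $\alpha_r = q^{2r-1} \alpha_{r-1}$, so the telescoped sum
reduces to its first term.
\<close>

lemma bailey_pair_unit:
  "bailey_pair L 1 (\<lambda>r. qpow \<tau> ((real r)\<^sup>2 - (real L)\<^sup>2) * (1 - qpow \<tau> (2 * real r + 1))) (bailey_kernel 0 L)"
  unfolding bailey_pair_def
proof
  fix M
  let ?\<alpha> = "\<lambda>r. qpow \<tau> ((real r)\<^sup>2 - (real L)\<^sup>2)"
  show "bailey_kernel 0 L M =
      (\<Sum>r=L..nat M. ?\<alpha> r * (1 - qpow \<tau> (2 * real r + 1)) * bailey_kernel 1 r M)"
  proof (cases "L \<le> nat M")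
    case True
    have "?\<alpha> r - (if r > L then qpow \<tau> (2 * real r - 1) * ?\<alpha> (r - 1) else 0) = (if r = L then 1 else 0)"
      if "r \<ge> L" for r
    proof (cases "r > L")
      case True
      hence "2 * real r - 1 + ((real (r - 1))\<^sup>2 - (real L)\<^sup>2) = (real r)\<^sup>2 - (real L)\<^sup>2"
        by (simp add: of_nat_diff power2_eq_square algebra_simps)
      thus ?thesis using True by (simp only: qpow_add[symmetric]) simp
    qed (use that in auto)
    hence "(\<Sum>r=L..nat M. (?\<alpha> r - (if r > L then qpow \<tau> (2 * real r - 1) * ?\<alpha> (r - 1) else 0)) * bailey_kernel 0 r M)
        = (\<Sum>r=L..nat M. if r = L then bailey_kernel 0 r M else 0)"
      by (intro sum.cong) auto
    also have "\<dots> = bailey_kernel 0 L M" using True by simp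
    finally show ?thesis
      unfolding sum_bailey_kernel_1_telescope[OF True] by (simp add: bailey_kernel_eq_0)
  next
    case False
    thus ?thesis by (simp add: bailey_kernel_eq_0)
  qed
qed

section \<open>Summation over the outermost variable\<close>

lemma summable_on_norm_q_power: "(\<lambda>n. norm q ^ n) summable_on (A :: nat set)"
proof -
  have "summable (\<lambda>n. norm (norm q ^ n))"
    using norm_q by (simp add: summable_geometric)
  hence "(\<lambda>n. norm q ^ n) summable_on UNIV"
    by (rule norm_summable_imp_summable_on)
  thus ?thesis by (rule summable_on_subset_banach) simp
qed

text \<open>
The sum of a Bailey pair against the outermost weight. The double series over $r$ and $n$ converges
absolutely, since $m^2/2 \ge m - 1/2$ makes the weight decay geometrically, and is summed in both
orders.
\<close>

lemma has_sum_bailey_pair: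
  fixes L c :: nat and l :: int
  assumes bp: "bailey_pair L c a \<beta>" and lL: "l \<le> int L"
    and a: "(\<lambda>r. norm (a r)) summable_on {L..}"
  shows "((\<lambda>n. qpow \<tau> ((of_int (int n + l))\<^sup>2 / 2 + real c * of_int (int n + l) - e) *
             qpoch (- qpow \<tau> (1/2)) q (nat (int n + l)) * \<beta> (int n + l))
          has_sum (\<Sum>\<^sub>\<infinity>r\<in>{L..}. a r * (qpow \<tau> ((real r)\<^sup>2 / 2 + real c * real r - e) *
             qpoch (- qpow \<tau> (1/2)) q r * qpoch_inf (- qpow \<tau> (real r + 1/2 + real c)) q / qpoch_inf q q)))
         UNIV"
proof -
  define w where "w = (\<lambda>m::int. qpow \<tau> ((of_int m)\<^sup>2 / 2 + real c * of_int m - e) *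
                        qpoch (- qpow \<tau> (1/2)) q (nat m))"
  define F where "F = (\<lambda>(r, n). a r * (w (int n + l) * bailey_kernel c r (int n + l)))"
  define S where "S = (\<lambda>r. qpow \<tau> ((real r)\<^sup>2 / 2 + real c * real r - e) *
             qpoch (- qpow \<tau> (1/2)) q r * qpoch_inf (- qpow \<tau> (real r + 1/2 + real c)) q / qpoch_inf q q)"

  obtain K1 where K1: "K1 > 0" "\<And>m. norm (inv_qfact q m) \<le> K1" using inv_qfact_bounded by blast
  obtain K2 where K2: "K2 > 0" "\<And>n. norm (qpoch (- qpow \<tau> (1/2)) q n) \<le> K2"
    using qpoch_bounded[OF norm_q] by blast
  define C where "C = norm (qpow \<tau> (of_int l - 1/2 - e)) * K2 * (K1 * K1)"
  have F_bound: "norm (F (r, n)) \<le> norm (a r) * (C * norm q ^ n)" for r n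
  proof (cases "int n + l \<ge> int r")
    case True
    define m where "m = int n + l"
    have m: "m \<ge> 0" using True by (simp add: m_def)
    have "(real_of_int m - 1)\<^sup>2 \<ge> 0" by simp
    hence "(real_of_int m)\<^sup>2 / 2 \<ge> real_of_int m - 1/2" by (simp add: power2_eq_square algebra_simps)
    moreover have "real c * real_of_int m \<ge> 0" using m by simp
    ultimately have "norm (qpow \<tau> ((of_int m)\<^sup>2 / 2 + real c * of_int m - e)) \<le> norm (qpow \<tau> ((of_int l - 1/2 - e) + real n))"
      by (intro norm_qpow_antimono) (simp add: m_def)
    also have "\<dots> = norm (qpow \<tau> (of_int l - 1/2 - e)) * norm q ^ n"
      unfolding qpow_add qpow_of_nat by (simp add: norm_mult norm_power)
    finally have 1: "norm (qpow \<tau> ((of_int m)\<^sup>2 / 2 + real c * of_int m - e))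
        \<le> norm (qpow \<tau> (of_int l - 1/2 - e)) * norm q ^ n" .
    have "norm (w m * bailey_kernel c r m) \<le>
       (norm (qpow \<tau> (of_int l - 1/2 - e)) * norm q ^ n * K2) * (K1 * K1)"
      unfolding w_def bailey_kernel_def norm_mult
      by (intro mult_mono 1 K1(2) K2(2)) (use K1(1) K2(1) in simp_all)
    also have "\<dots> = C * norm q ^ n" by (simp add: C_def mult_ac)
    finally show ?thesis
      unfolding F_def prod.case norm_mult[of "a r"] m_def[symmetric] by (intro mult_left_mono) simp_all
  next
    case False
    hence "F (r, n) = 0" by (simp add: F_def bailey_kernel_eq_0)
    moreover have "C \<ge> 0" using K1(1) K2(1) by (simp add: C_def)
    ultimately show ?thesis by simp
  qed

  have F_summable: "F summable_on {L..} \<times> UNIV"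
  proof -
    define G where "G = (\<lambda>(r, n). norm (a r) * (C * norm q ^ n))"
    have C: "C \<ge> 0" using K1(1) K2(1) by (simp add: C_def)
    have "G summable_on {L..} \<times> UNIV"
    proof (rule summable_on_SigmaI)
      fix r :: nat
      have "((\<lambda>n. norm q ^ n) has_sum (\<Sum>\<^sub>\<infinity>n. norm q ^ n)) UNIV"
        by (rule has_sum_infsum) (rule summable_on_norm_q_power)
      thus "((\<lambda>n. G (r, n)) has_sum (norm (a r) * (C * (\<Sum>\<^sub>\<infinity>n. norm q ^ n)))) UNIV"
        unfolding G_def prod.case by (intro has_sum_cmult_right)
    next
      show "(\<lambda>r. norm (a r) * (C * (\<Sum>\<^sub>\<infinity>n. norm q ^ n))) summable_on {L..}"
        by (rule summable_on_cmult_left[OF a])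
    qed (use C in \<open>simp add: G_def\<close>)
    hence "(\<lambda>x. norm (F x)) summable_on {L..} \<times> UNIV"
    proof (rule Infinite_Sum.abs_summable_on_comparison_test')
      fix x
      show "norm (F x) \<le> G x"
        using F_bound[of "fst x" "snd x"] by (simp add: G_def case_prod_unfold)
    qed
    thus ?thesis by (rule abs_summable_summable)
  qed

  have row: "((\<lambda>n. F (r, n)) has_sum (a r * S r)) UNIV" if "r \<in> {L..}" for r
  proof -
    \<comment> \<open>The terms with $n < d$ vanish, where $d$ is the value of $n$ at which $M = n + l$ equals $r$.\<close>
    define d where "d = nat (int r - l)"
    have d: "int d = int r - l" using that lL by (simp add: d_def)
    have shift: "int (s + d) + l = int (r + s)" for s using d by simp
    have qe: "qpow \<tau> (x - e) = qpow \<tau> (- e) * qpow \<tau> x" for x by (simp flip: qpow_add)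
    let ?f = "\<lambda>s. qpow \<tau> ((real (r + s))\<^sup>2 / 2 + real c * real (r + s)) *
             qpoch (- qpow \<tau> (1/2)) q (r + s) * bailey_kernel c r (int (r + s))"
    let ?T = "qpow \<tau> ((real r)\<^sup>2 / 2 + real c * real r) * qpoch (- qpow \<tau> (1/2)) q r *
           qpoch_inf (- qpow \<tau> (real r + 1/2 + real c)) q / qpoch_inf q q"
    have "(?f has_sum ?T) UNIV"
      by (rule norm_summable_imp_has_sum[OF sums_bailey_kernel])
    hence "((\<lambda>s. a r * (qpow \<tau> (- e) * ?f s)) has_sum (a r * (qpow \<tau> (- e) * ?T))) UNIV"
      by (intro has_sum_cmult_right)
    moreover have "a r * (qpow \<tau> (- e) * ?T) = a r * S r"
      unfolding S_def qe by (simp add: mult_ac)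
    moreover have "(\<lambda>s. a r * (qpow \<tau> (- e) * ?f s)) = (\<lambda>n. F (r, n)) \<circ> (\<lambda>s. s + d)"
      unfolding F_def w_def comp_def prod.case shift qe nat_int of_int_of_nat_eq by (simp only: mult_ac)
    ultimately have "((\<lambda>n. F (r, n)) \<circ> (\<lambda>s. s + d) has_sum (a r * S r)) UNIV" by simp
    hence "((\<lambda>n. F (r, n)) has_sum (a r * S r)) ((\<lambda>s. s + d) ` UNIV)"
      by (subst has_sum_reindex) (auto simp: inj_on_def)
    moreover have "((\<lambda>n. F (r, n)) has_sum (a r * S r)) ((\<lambda>s. s + d) ` UNIV) \<longleftrightarrow>
                   ((\<lambda>n. F (r, n)) has_sum (a r * S r)) UNIV"
    proof (rule has_sum_cong_neutral)
      fix n assume n: "n \<in> UNIV - (\<lambda>s. s + d) ` UNIV"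
      have "n < d"
      proof (rule ccontr)
        assume "\<not> n < d"
        hence "n = (n - d) + d" by simp
        with n show False by blast
      qed
      hence "int n + l < int r" using d by linarith
      thus "F (r, n) = 0" by (simp add: F_def bailey_kernel_eq_0)
    qed auto
    ultimately show ?thesis by blast
  qed

  have col: "((\<lambda>r. F (r, n)) has_sum (w (int n + l) * \<beta> (int n + l))) {L..}" for n
  proof -
    have "((\<lambda>r. F (r, n)) has_sum (\<Sum>r=L..nat (int n + l). F (r, n))) {L..nat (int n + l)}"
      by (rule has_sum_finite) simp
    moreover have "(\<Sum>r=L..nat (int n + l). F (r, n)) = w (int n + l) * \<beta> (int n + l)"
      using bp by (simp add: bailey_pair_def F_def sum_distrib_left mult_ac)
    moreover have "((\<lambda>r. F (r, n)) has_sum x) {L..nat (int n + l)} \<longleftrightarrow> ((\<lambda>r. F (r, n)) has_sum x) {L..}" for x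
      by (rule has_sum_cong_neutral) (auto simp: F_def bailey_kernel_eq_0)
    ultimately show ?thesis by metis
  qed

  define T where "T = infsum F ({L..} \<times> UNIV)"
  have F_sum: "(F has_sum T) ({L..} \<times> UNIV)"
    unfolding T_def using F_summable by (rule has_sum_infsum)
  hence "((\<lambda>r. a r * S r) has_sum T) {L..}"
    by (rule has_sum_SigmaD) (rule row)
  hence T: "T = (\<Sum>\<^sub>\<infinity>r\<in>{L..}. a r * S r)"
    by (simp only: infsumI)
  have "((\<lambda>(n, r). F (r, n)) has_sum T) (UNIV \<times> {L..})"
    using F_sum has_sum_swap[where f = F and S = T and A = "{L..}" and B = UNIV] by blast
  hence "((\<lambda>n. w (int n + l) * \<beta> (int n + l)) has_sum T) UNIV"
    by (rule has_sum_SigmaD) (simp only: prod.case, rule col)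
  thus ?thesis unfolding T w_def S_def by (simp only: mult.assoc)
qed

section \<open>Peeling off the innermost variable\<close>

text \<open>
The summand of a multisum of Bailey chain type: a weight $w_j$ evaluated at each $M_j = N_j + l$,
factors $1/(q)_{n_j} = 1/(q)_{M_j - M_{j+1}}$ for $j < k$, and an arbitrary function \<open>\<beta>\<close> of
the innermost $M_k = n_k + l$ that stands for the last factors.
\<close>

definition chain_term ::
    "int \<Rightarrow> nat \<Rightarrow> (nat \<Rightarrow> int \<Rightarrow> complex) \<Rightarrow> (int \<Rightarrow> complex) \<Rightarrow> (nat \<Rightarrow> nat) \<Rightarrow> complex" where
  "chain_term l k w \<beta> n =
     (\<Prod>j=1..k. w j (int (tail_sum k n j) + l)) * (\<Prod>j\<in>{1..<k}. inv_qfact q (int (n j)))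
     * \<beta> (int (n k) + l)"

text \<open>
With $k + 1$ variables, let $s$ be the value of the innermost one and replace $n_k$ by
$n_k + s = N_k$. For fixed new $n_k$ the sum over $s \le n_k$ is finite, and carrying it out leaves a
multisum with $k$ variables.
\<close>

lemma has_sum_chain_term_peel:
  assumes "k \<ge> 1" "(chain_term l (Suc k) w \<beta> has_sum S) ({1..Suc k} \<rightarrow>\<^sub>E UNIV)"
  shows "(chain_term l k w (\<lambda>M. \<Sum>m\<in>{l..M}. w (Suc k) m * \<beta> m * inv_qfact q (M - m)) has_sum S)
           ({1..k} \<rightarrow>\<^sub>E UNIV)"
proof -
  define split :: "(nat \<Rightarrow> nat) \<times> nat \<Rightarrow> nat \<Rightarrow> nat"
    where "split = (\<lambda>(n, s). n(k := n k - s, Suc k := s))"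
  \<comment> \<open>The coordinate $k + 1$ is reset to \<open>undefined\<close>, so that the function is again
      extensional on $\{1, \dots, k\}$.\<close>
  define merge :: "(nat \<Rightarrow> nat) \<Rightarrow> (nat \<Rightarrow> nat) \<times> nat"
    where "merge = (\<lambda>n. (n(k := n k + n (Suc k), Suc k := undefined), n (Suc k)))"
  have tail: "tail_sum (Suc k) (split (n, s)) j = (if j = Suc k then s else tail_sum k n j)"
    if "s \<le> n k" "j \<in> {1..Suc k}" for n s j
  proof (cases "j = Suc k")
    case False
    hence "{j..Suc k} = insert k (insert (Suc k) {j..<k})" "{j..k} = insert k {j..<k}"
      using that by auto
    thus ?thesis using False that by (simp add: tail_sum_def split_def)
  qed (simp add: tail_sum_def split_def)
  have "((\<lambda>x. chain_term l (Suc k) w \<beta> (split x)) has_sum S)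
          (Sigma ({1..k} \<rightarrow>\<^sub>E UNIV) (\<lambda>n. {..n k}))
        \<longleftrightarrow> (chain_term l (Suc k) w \<beta> has_sum S) ({1..Suc k} \<rightarrow>\<^sub>E UNIV)"
  proof (rule has_sum_reindex_bij_witness[of _ merge split])
    fix x :: "(nat \<Rightarrow> nat) \<times> nat"
    assume x: "x \<in> Sigma ({1..k} \<rightarrow>\<^sub>E UNIV) (\<lambda>n. {..n k})"
    then obtain n s where ns: "x = (n, s)" "n \<in> {1..k} \<rightarrow>\<^sub>E UNIV" "s \<le> n k" by auto
    have "n (Suc k) = undefined" using ns(2) by (auto simp: PiE_def extensional_def)
    thus "merge (split x) = x" using ns by (auto simp: merge_def split_def fun_eq_iff)
    show "split x \<in> {1..Suc k} \<rightarrow>\<^sub>E UNIV"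
      using ns assms(1) by (auto simp: split_def PiE_def extensional_def)
  next
    fix n :: "nat \<Rightarrow> nat" assume n: "n \<in> {1..Suc k} \<rightarrow>\<^sub>E UNIV"
    show "split (merge n) = n" by (auto simp: merge_def split_def fun_eq_iff)
    show "merge n \<in> Sigma ({1..k} \<rightarrow>\<^sub>E UNIV) (\<lambda>n. {..n k})"
      using n assms(1) by (auto simp: merge_def PiE_def extensional_def)
  qed simp_all
  with assms(2) have sum: "((\<lambda>x. chain_term l (Suc k) w \<beta> (split x)) has_sum S)
          (Sigma ({1..k} \<rightarrow>\<^sub>E UNIV) (\<lambda>n. {..n k}))" by blast
  show ?thesis
  proof (rule has_sum_SigmaD[OF sum])
    fix n :: "nat \<Rightarrow> nat"
    assume "n \<in> {1..k} \<rightarrow>\<^sub>E UNIV"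
    define W where "W = (\<Prod>j=1..k. w j (int (tail_sum k n j) + l)) * (\<Prod>j\<in>{1..<k}. inv_qfact q (int (n j)))"
    have term_eq: "chain_term l (Suc k) w \<beta> (split (n, s)) =
        W * (w (Suc k) (int s + l) * \<beta> (int s + l) * inv_qfact q (int (n k) - int s))" if "s \<le> n k" for s
    proof -
      have "(\<Prod>j=1..Suc k. w j (int (tail_sum (Suc k) (split (n, s)) j) + l)) =
            (\<Prod>j=1..k. w j (int (tail_sum k n j) + l)) * w (Suc k) (int s + l)"
        using tail[where n = n and s = s, OF that] by simp
      moreover have "(\<Prod>j\<in>{1..<Suc k}. inv_qfact q (int (split (n, s) j))) =
            (\<Prod>j\<in>{1..<k}. inv_qfact q (int (n j))) * inv_qfact q (int (n k) - int s)"
      proof -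
        have "{1..<Suc k} = insert k {1..<k}" using assms(1) by auto
        moreover have "(\<Prod>j\<in>{1..<k}. inv_qfact q (int (split (n, s) j))) = (\<Prod>j\<in>{1..<k}. inv_qfact q (int (n j)))"
          by (intro prod.cong) (auto simp: split_def)
        ultimately show ?thesis using that by (simp add: split_def of_nat_diff)
      qed
      moreover have "split (n, s) (Suc k) = s" by (simp add: split_def)
      ultimately show ?thesis unfolding chain_term_def W_def by (simp only: mult_ac)
    qed
    have "((\<lambda>s. chain_term l (Suc k) w \<beta> (split (n, s))) has_sum
            (\<Sum>s\<le>n k. chain_term l (Suc k) w \<beta> (split (n, s)))) {..n k}"
      by (rule has_sum_finite) simp
    also have "(\<Sum>s\<le>n k. chain_term l (Suc k) w \<beta> (split (n, s))) =
       (\<Sum>s\<le>n k. W * (w (Suc k) (int s + l) * \<beta> (int s + l) * inv_qfact q (int (n k) - int s)))"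
      by (intro sum.cong) (auto simp: term_eq)
    also have "\<dots> = W * (\<Sum>s\<le>n k. w (Suc k) (int s + l) * \<beta> (int s + l) * inv_qfact q (int (n k) - int s))"
      by (simp only: sum_distrib_left)
    also have "(\<Sum>s\<le>n k. w (Suc k) (int s + l) * \<beta> (int s + l) * inv_qfact q (int (n k) - int s)) =
       (\<Sum>m\<in>{l..int (n k) + l}. w (Suc k) m * \<beta> m * inv_qfact q (int (n k) + l - m))"
      by (rule sum.reindex_bij_witness[of _ "\<lambda>m. nat (m - l)" "\<lambda>s. int s + l"]) auto
    finally show "((\<lambda>s. chain_term l (Suc k) w \<beta> (split (n, s))) has_sum
        chain_term l k w (\<lambda>M. \<Sum>m\<in>{l..M}. w (Suc k) m * \<beta> m * inv_qfact q (M - m)) n) {..n k}"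
      by (simp only: chain_term_def W_def)
  qed
qed

text \<open>
If the innermost $p$ weights are those of the Bailey chain with parameter $q^c$, then summing over
these $p$ variables applies Bailey's lemma $p$ times to the pair.
\<close>

lemma has_sum_chain_term_bailey:
  assumes "k \<ge> 1" "(chain_term l (k + p) w \<beta> has_sum S) ({1..k + p} \<rightarrow>\<^sub>E UNIV)"
    and "bailey_pair L c a \<beta>" "l \<le> int L"
    and "\<And>j m. j \<in> {k<..k + p} \<Longrightarrow> w j m = qpow \<tau> ((of_int m)\<^sup>2 + real c * of_int m - e)"
  shows "\<exists>\<beta>'. (chain_term l k w \<beta>' has_sum S) ({1..k} \<rightarrow>\<^sub>E UNIV) \<and>
              bailey_pair L c (\<lambda>r. a r * qpow \<tau> (real p * ((real r)\<^sup>2 + real c * real r - e))) \<beta>'"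
  using assms(2,3,5)
proof (induction p arbitrary: a \<beta>)
  case 0
  thus ?case by auto
next
  case (Suc p)
  let ?\<beta>' = "\<lambda>M. \<Sum>m\<in>{l..M}. w (Suc (k + p)) m * \<beta> m * inv_qfact q (M - m)"
  have w: "w (Suc (k + p)) m = qpow \<tau> ((of_int m)\<^sup>2 + real c * of_int m - e)" for m
    by (rule Suc.prems) simp
  have "(chain_term l (k + p) w ?\<beta>' has_sum S) ({1..k + p} \<rightarrow>\<^sub>E UNIV)"
    by (rule has_sum_chain_term_peel) (use Suc.prems(1) assms(1) in simp_all)
  moreover have "bailey_pair L c (\<lambda>r. a r * qpow \<tau> ((real r)\<^sup>2 + real c * real r - e)) ?\<beta>'"
    unfolding w by (rule bailey_lemma[OF Suc.prems(2) assms(4)])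
  ultimately have "\<exists>\<beta>'. (chain_term l k w \<beta>' has_sum S) ({1..k} \<rightarrow>\<^sub>E UNIV) \<and>
     bailey_pair L c (\<lambda>r. (a r * qpow \<tau> ((real r)\<^sup>2 + real c * real r - e))
        * qpow \<tau> (real p * ((real r)\<^sup>2 + real c * real r - e))) \<beta>'"
    by (rule Suc.IH) (rule Suc.prems, simp)
  moreover have "(a r * qpow \<tau> ((real r)\<^sup>2 + real c * real r - e)) * qpow \<tau> (real p * ((real r)\<^sup>2 + real c * real r - e))
     = a r * qpow \<tau> (real (Suc p) * ((real r)\<^sup>2 + real c * real r - e))" for r
    by (simp add: mult.assoc flip: qpow_add) (simp add: algebra_simps)
  ultimately show ?case by simp
qed

lemma has_sum_chain_term_1:
  assumes "(chain_term l 1 w \<beta> has_sum S) ({1..1} \<rightarrow>\<^sub>E UNIV)"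
  shows "((\<lambda>n. w 1 (int n + l) * \<beta> (int n + l)) has_sum S) UNIV"
proof -
  have "((\<lambda>n. w 1 (int n + l) * \<beta> (int n + l)) has_sum S) UNIV \<longleftrightarrow>
        (chain_term l 1 w \<beta> has_sum S) ({1..1} \<rightarrow>\<^sub>E UNIV)"
    by (rule has_sum_reindex_bij_witness[of _ "\<lambda>n. n 1" "\<lambda>n. (\<lambda>j\<in>{1..1}. n)"])
       (auto simp: fun_eq_iff PiE_def extensional_def chain_term_def tail_sum_def)
  with assms show ?thesis by blast
qed

section \<open>Exponents and convergence of the two series\<close>

lemma qpow_sum: "qpow \<tau> (\<Sum>j\<in>A. f j) = (\<Prod>j\<in>A. qpow \<tau> (f j))"
  by (induction A rule: infinite_finite_induct) (simp_all add: qpow_add)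

lemma theta_exponent_eq:
  "theta_exponent k i l n = (real k + 1/2) * ((of_int n)\<^sup>2 - (of_int l)\<^sup>2) + real i * (of_int n - of_int l)"
proof -
  define d :: real where "d = 2 * real k + 1"
  have d: "d > 0" "real k + 1/2 = d / 2" "4 * real k + 2 = 2 * d"
    by (simp_all add: d_def field_simps)
  have e: "2 * real k * of_int l + real i + of_int l = d * of_int l + real i"
    by (simp add: d_def algebra_simps)
  show ?thesis
    unfolding theta_exponent_def e d(2,3) d_def[symmetric] using d(1)
    by (simp add: power2_eq_square field_simps)
qed

lemma theta_exponent_ge:
  assumes "i \<le> k"
  shows "theta_exponent k i l n \<ge> \<bar>of_int n\<bar> + (- 1/2 - (real k + 1/2) * (of_int l)\<^sup>2 - real i * of_int l)"
proof -
  define x :: real where "x = \<bar>of_int n\<bar>"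
  have x2: "(of_int n :: real)\<^sup>2 = x\<^sup>2" by (simp add: x_def)
  have "\<bar>n\<bar> * 1 \<le> \<bar>n\<bar> * \<bar>n\<bar>" by (cases "n = 0") (simp, intro mult_left_mono, auto)
  hence "real_of_int (\<bar>n\<bar> * 1) \<le> real_of_int (\<bar>n\<bar> * \<bar>n\<bar>)" by (rule of_int_le_iff[THEN iffD2])
  hence "x \<le> x\<^sup>2" by (simp add: x_def power2_eq_square)
  hence 1: "real k * x \<le> real k * x\<^sup>2" by (intro mult_left_mono) auto
  have "real i * of_int n \<ge> - (real i * x)"
    using mult_left_mono[of "- x" "of_int n" "real i"] by (simp add: x_def)
  moreover have "real i * x \<le> real k * x" using assms by (intro mult_right_mono) (auto simp: x_def)
  moreover have "(x - 1)\<^sup>2 \<ge> 0" by simp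
  hence "x\<^sup>2 / 2 \<ge> x - 1/2" by (simp add: power2_eq_square algebra_simps)
  ultimately show ?thesis
    unfolding theta_exponent_eq x2 x_def[symmetric] using 1 by (simp add: algebra_simps)
qed

lemma norm_qpow_le_power:
  assumes "a \<ge> real n + b"
  shows "norm (qpow \<tau> a) \<le> norm (qpow \<tau> b) * norm q ^ n"
proof -
  have "norm (qpow \<tau> a) \<le> norm (qpow \<tau> (real n + b))" by (rule norm_qpow_antimono[OF assms])
  thus ?thesis unfolding qpow_add qpow_of_nat by (simp add: norm_mult norm_power mult.commute)
qed

lemma summable_on_norm_q_power_abs: "(\<lambda>n::int. norm q ^ nat \<bar>n\<bar>) summable_on A"
proof -
  let ?f = "\<lambda>n::int. norm q ^ nat \<bar>n\<bar>"
  have "?f \<circ> int = (\<lambda>n. norm q ^ n)" by auto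
  hence 1: "?f summable_on range int"
    using summable_on_norm_q_power[of UNIV] by (subst summable_on_reindex) simp_all
  have "?f \<circ> (\<lambda>n. - int n) = (\<lambda>n. norm q ^ n)" by auto
  hence 2: "?f summable_on ((\<lambda>n. - int n) ` {0<..})"
    using summable_on_norm_q_power[of "{0<..}"] by (subst summable_on_reindex) (simp_all add: inj_on_def)
  have "UNIV = range int \<union> (\<lambda>n. - int n) ` {0<..}"
  proof -
    have "m \<in> range int \<union> (\<lambda>n. - int n) ` {0<..}" for m :: int
    proof (cases "m \<ge> 0")
      case True
      hence "m = int (nat m)" by simp
      thus ?thesis by blast
    next
      case False
      hence "m = - int (nat (- m))" "nat (- m) \<in> {0<..}" by auto
      thus ?thesis by blast
    qed
    thus ?thesis by blast
  qed
  moreover have "?f summable_on (range int \<union> (\<lambda>n. - int n) ` {0<..})"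
    by (rule summable_on_Un_disjoint[OF 1 2]) auto
  ultimately have "?f summable_on UNIV" by simp
  thus ?thesis by (rule summable_on_subset_banach) simp
qed

lemma summable_on_theta:
  assumes "i \<le> k"
  shows "(\<lambda>n. qpow \<tau> (theta_exponent k i l n)) summable_on A"
proof -
  define b where "b = - 1/2 - (real k + 1/2) * (of_int l)\<^sup>2 - real i * of_int l"
  have "norm (qpow \<tau> (theta_exponent k i l n)) \<le> norm (qpow \<tau> b) * norm q ^ nat \<bar>n\<bar>" for n
    by (rule norm_qpow_le_power) (use theta_exponent_ge[OF assms, of n l] in \<open>simp add: b_def\<close>)
  hence "(\<lambda>n. norm (qpow \<tau> (theta_exponent k i l n))) summable_on A"
    by (intro Infinite_Sum.abs_summable_on_comparison_test'[OF
          summable_on_cmult_right[OF summable_on_norm_q_power_abs]])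
  thus ?thesis by (rule abs_summable_summable)
qed

text \<open>
The part of the exponent of the multisum that depends on $M_j$, after the squares are completed.
\<close>

definition chain_exponent :: "nat \<Rightarrow> nat \<Rightarrow> int \<Rightarrow> nat \<Rightarrow> real \<Rightarrow> real" where
  "chain_exponent k i l j M =
     (if j = 1 then (M\<^sup>2 - (of_int l)\<^sup>2) / 2 else M\<^sup>2 - (of_int l)\<^sup>2)
     + (if j > k - i then M - of_int l else 0)"

lemma multisum_exponent_eq:
  assumes "k \<ge> 1" "i \<le> k"
  shows "multisum_exponent k i l n = (\<Sum>j=1..k. chain_exponent k i l j (of_int (int (tail_sum k n j) + l)))"
proof -
  define N where "N = (\<lambda>j. real (tail_sum k n j))"
  define u where "u = (\<lambda>j. if j > k - i then 0 else N j)"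
  have ins: "{1..k} = insert 1 {2..k}" using assms(1) by auto
  have "(\<Sum>j=1..k-i. N j) = (\<Sum>j=1..k. u j)"
    unfolding u_def by (rule sum.mono_neutral_cong_left) auto
  hence "(\<Sum>j=1..k-i. N j) = u 1 + (\<Sum>j=2..k. u j)" unfolding ins by simp
  hence "multisum_exponent k i l n = (N 1 * (N 1 + 1) / 2 + (of_int l + 1/2) * N 1 - u 1)
     + ((\<Sum>j=2..k. (N j)\<^sup>2) + (2 * of_int l + 1) * (\<Sum>j=2..k. N j) - (\<Sum>j=2..k. u j))"
    by (simp add: multisum_exponent_def Let_def flip: N_def)
  also have "N 1 * (N 1 + 1) / 2 + (of_int l + 1/2) * N 1 - u 1 = chain_exponent k i l 1 (N 1 + of_int l)"
    by (simp add: chain_exponent_def u_def power2_eq_square field_simps)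
  also have "(\<Sum>j=2..k. (N j)\<^sup>2) + (2 * of_int l + 1) * (\<Sum>j=2..k. N j) - (\<Sum>j=2..k. u j)
     = (\<Sum>j=2..k. (N j)\<^sup>2 + (2 * of_int l + 1) * N j - u j)"
    by (simp only: sum_subtractf sum.distrib sum_distrib_left)
  also have "\<dots> = (\<Sum>j=2..k. chain_exponent k i l j (N j + of_int l))"
    by (intro sum.cong refl) (simp add: chain_exponent_def u_def power2_eq_square algebra_simps)
  finally show ?thesis unfolding ins by (simp add: N_def)
qed

text \<open>
The $j$-th weight of the multisum as a chain: for $j \ge 2$ it is $q^{M^2 + cM}$ up to a constant,
with $c = 1$ for $j > k - i$ and $c = 0$ otherwise, and for $j = 1$ it is the outermost weight, which
contains $(-q^{1/2})_M$. Negative $M$ do not contribute.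
\<close>

definition chain_weight :: "nat \<Rightarrow> nat \<Rightarrow> int \<Rightarrow> nat \<Rightarrow> int \<Rightarrow> complex" where
  "chain_weight k i l j M = qpow \<tau> (chain_exponent k i l j (of_int M))
     * (if j = 1 then qpoch (- qpow \<tau> (1/2)) q (nat M) else 1)"

lemma multisum_term_eq_chain_term:
  assumes "k \<ge> 1" "i \<le> k"
  shows "multisum_term \<tau> k i l n = chain_term l k (chain_weight k i l) (bailey_kernel 0 (nat \<bar>l\<bar>)) n"
proof -
  let ?M = "\<lambda>j. int (tail_sum k n j) + l"
  have ins: "{1..k} = insert 1 {2..k}" "{1..k} = insert k {1..<k}" using assms(1) by auto
  have "(\<Prod>j=1..k. chain_weight k i l j (?M j)) = qpow \<tau> (multisum_exponent k i l n) *
     (\<Prod>j=1..k. if j = 1 then qpoch (- qpow \<tau> (1/2)) q (nat (?M j)) else 1)"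
    unfolding multisum_exponent_eq[OF assms] qpow_sum chain_weight_def by (simp only: prod.distrib)
  also have "(\<Prod>j=1..k. if j = 1 then qpoch (- qpow \<tau> (1/2)) q (nat (?M j)) else 1)
     = qpoch (- qpow \<tau> (1/2)) q (nat (?M 1))"
    using assms(1) by simp
  finally have 1: "(\<Prod>j=1..k. chain_weight k i l j (?M j)) =
      qpow \<tau> (multisum_exponent k i l n) * qpoch (- qpow \<tau> (1/2)) q (nat (?M 1))" .
  have 2: "1 / (\<Prod>j=1..k. qpoch q q (n j)) = (\<Prod>j\<in>{1..<k}. inv_qfact q (int (n j))) * inv_qfact q (int (n k))"
    unfolding ins(2) inv_qfact_of_nat by (simp add: prod_dividef)
  have 3: "bailey_kernel 0 (nat \<bar>l\<bar>) (int (n k) + l) = inv_qfact q (int (n k)) * inv_qfact q (int (n k) + 2 * l)"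
    by (cases "l \<ge> 0") (simp_all add: bailey_kernel_def mult.commute add.commute)
  have "multisum_term \<tau> k i l n = (qpow \<tau> (multisum_exponent k i l n) * qpoch (- qpow \<tau> (1/2)) q (nat (?M 1)))
     * (1 / (\<Prod>j=1..k. qpoch q q (n j))) * inv_qfact q (int (n k) + 2 * l)"
    by (simp add: multisum_term_def)
  thus ?thesis
    unfolding chain_term_def 1 2 3 by (simp only: mult.assoc)
qed

text \<open>
Unless the summand vanishes, $M_j \ge |l|$ for all $j$. Then every part of the exponent is
nonnegative, and the first one is at least $N_1$ up to a constant. As $N_1 = n_1 + \dots + n_k$, the
summand is dominated by a product of geometric sequences.
\<close>

lemma summable_on_multisum_term:
  assumes "k \<ge> 1" "i \<le> k"
  shows "multisum_term \<tau> k i l summable_on ({1..k} \<rightarrow>\<^sub>E UNIV)"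
proof -
  obtain K1 where K1: "K1 > 0" "\<And>m. norm (inv_qfact q m) \<le> K1" using inv_qfact_bounded by blast
  obtain K2 where K2: "K2 > 0" "\<And>n. norm (qpoch (- qpow \<tau> (1/2)) q n) \<le> K2"
    using qpoch_bounded[OF norm_q] by blast
  define b where "b = real_of_int l - 1/2 - (real_of_int l)\<^sup>2 / 2"
  define C where "C = norm (qpow \<tau> b) * K2 * K1 ^ k * K1"
  have bound: "norm (multisum_term \<tau> k i l n) \<le> C * (\<Prod>j=1..k. norm q ^ n j)" for n
  proof (cases "int (n k) + 2 * l < 0")
    case True
    moreover have "C \<ge> 0" using K1(1) K2(1) by (simp add: C_def)
    ultimately show ?thesis
      by (simp add: multisum_term_def prod_nonneg)
  next
    case False
    have M: "real_of_int (int (tail_sum k n j) + l) \<ge> \<bar>of_int l\<bar>" if "j \<in> {1..k}" for j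
    proof -
      have "n k \<le> tail_sum k n j"
        unfolding tail_sum_def using that by (intro member_le_sum) auto
      hence "int (tail_sum k n j) + l \<ge> \<bar>l\<bar>" using False by auto
      thus ?thesis by linarith
    qed
    have sq: "(real_of_int (int (tail_sum k n j) + l))\<^sup>2 \<ge> (of_int l)\<^sup>2" if "j \<in> {1..k}" for j
      using M[OF that] by (metis abs_ge_zero power2_abs power_mono)
    have nonneg: "chain_exponent k i l j (of_int (int (tail_sum k n j) + l)) \<ge> 0" if "j \<in> {1..k}" for j
      using sq[OF that] M[OF that] by (auto simp: chain_exponent_def)
    have "(real_of_int (int (tail_sum k n 1) + l) - 1)\<^sup>2 \<ge> 0" by simp
    hence "real (tail_sum k n 1) + b \<le> chain_exponent k i l 1 (of_int (int (tail_sum k n 1) + l))"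
      using M[of 1] assms(1) by (simp add: chain_exponent_def b_def power2_eq_square field_simps)
    also have "\<dots> \<le> multisum_exponent k i l n"
      unfolding multisum_exponent_eq[OF assms] using assms(1) by (intro member_le_sum nonneg) auto
    finally have 1: "norm (qpow \<tau> (multisum_exponent k i l n)) \<le> norm (qpow \<tau> b) * norm q ^ tail_sum k n 1"
      by (rule norm_qpow_le_power)
    have 2: "norm (\<Prod>j=1..k. inv_qfact q (int (n j))) \<le> K1 ^ k"
    proof -
      have "norm (\<Prod>j=1..k. inv_qfact q (int (n j))) \<le> (\<Prod>j=1..k. K1)"
        unfolding prod_norm[symmetric] using K1(2) by (intro prod_mono) auto
      thus ?thesis by simp
    qed
    have "multisum_term \<tau> k i l n = qpow \<tau> (multisum_exponent k i l n)
       * qpoch (- qpow \<tau> (1/2)) q (nat (int (tail_sum k n 1) + l))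
       * (\<Prod>j=1..k. inv_qfact q (int (n j))) * inv_qfact q (int (n k) + 2 * l)"
      by (simp add: multisum_term_def inv_qfact_of_nat prod_dividef)
    also have "norm \<dots> \<le> (norm (qpow \<tau> b) * norm q ^ tail_sum k n 1) * K2 * K1 ^ k * K1"
      unfolding norm_mult by (intro mult_mono 1 2 K1(2) K2(2)) (use K1(1) K2(1) in simp_all)
    also have "norm q ^ tail_sum k n 1 = (\<Prod>j=1..k. norm q ^ n j)"
      by (simp add: tail_sum_def power_sum)
    finally show ?thesis by (simp only: C_def mult_ac)
  qed
  have "Infinite_Set_Sum.abs_summable_on (\<lambda>m. norm q ^ m) (UNIV :: nat set)"
    using summable_on_norm_q_power[of UNIV] by (simp flip: abs_summable_equivalent add: norm_power)
  hence "Infinite_Set_Sum.abs_summable_on (\<lambda>n. \<Prod>j\<in>{1..k}. norm q ^ n j) ({1..k} \<rightarrow>\<^sub>E (UNIV :: nat set))"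
    by (intro abs_summable_on_prod_PiE) auto
  hence "(\<lambda>n. norm (\<Prod>j\<in>{1..k}. norm q ^ n j)) summable_on ({1..k} \<rightarrow>\<^sub>E (UNIV :: nat set))"
    by (simp only: abs_summable_equivalent)
  hence "(\<lambda>n. \<Prod>j\<in>{1..k}. norm q ^ n j) summable_on ({1..k} \<rightarrow>\<^sub>E (UNIV :: nat set))"
    by (simp add: prod_nonneg abs_of_nonneg)
  hence "(\<lambda>n. C * (\<Prod>j\<in>{1..k}. norm q ^ n j)) summable_on ({1..k} \<rightarrow>\<^sub>E (UNIV :: nat set))"
    by (rule summable_on_cmult_right)
  hence "(\<lambda>n. norm (multisum_term \<tau> k i l n)) summable_on ({1..k} \<rightarrow>\<^sub>E UNIV)"
    by (rule Infinite_Sum.abs_summable_on_comparison_test') (rule bound)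
  thus ?thesis by (rule abs_summable_summable)
qed

lemma summable_on_norm_qpow_diff:
  assumes "\<And>r. r \<ge> L \<Longrightarrow> A r \<ge> real r + b" "\<And>r. r \<ge> L \<Longrightarrow> P r \<Longrightarrow> B r \<ge> real r + b"
  shows "(\<lambda>r. norm (qpow \<tau> (A r) - (if P r then qpow \<tau> (B r) else 0))) summable_on {L..}"
proof (rule Infinite_Sum.abs_summable_on_comparison_test'[OF
          summable_on_cmult_right[OF summable_on_norm_q_power]])
  fix r assume "r \<in> {L..}"
  hence r: "r \<ge> L" by simp
  have "norm (qpow \<tau> (A r) - (if P r then qpow \<tau> (B r) else 0))
     \<le> norm (qpow \<tau> (A r)) + norm (if P r then qpow \<tau> (B r) else 0)" by (rule norm_triangle_ineq4)
  also have "norm (if P r then qpow \<tau> (B r) else 0) \<le> norm (qpow \<tau> b) * norm q ^ r"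
    using norm_qpow_le_power[OF assms(2)[OF r]] by auto
  also have "norm (qpow \<tau> (A r)) \<le> norm (qpow \<tau> b) * norm q ^ r"
    by (rule norm_qpow_le_power[OF assms(1)[OF r]])
  finally show "norm (qpow \<tau> (A r) - (if P r then qpow \<tau> (B r) else 0)) \<le> (2 * norm (qpow \<tau> b)) * norm q ^ r"
    by simp
qed

lemma qpoch_inf_half_split:
  "qpoch (- qpow \<tau> (1/2)) q r * qpoch_inf (- qpow \<tau> (real r + 1/2)) q = qpoch_inf (- qpow \<tau> (1/2)) q"
proof -
  have "- qpow \<tau> (1/2) * q ^ r = - qpow \<tau> (real r + 1/2)"
    unfolding qpow_add qpow_of_nat by simp
  thus ?thesis using qpoch_inf_split[OF norm_q, of "- qpow \<tau> (1/2)" r] by simp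
qed

section \<open>Evaluation of the multisum\<close>

abbreviation theta_term :: "nat \<Rightarrow> nat \<Rightarrow> int \<Rightarrow> int \<Rightarrow> complex" where
  "theta_term k i l n \<equiv> qpow \<tau> (theta_exponent k i l n)"

text \<open>
The case $i < k$. The change of parameter leaves each $r > L$ with two contributions, which end up as
the theta terms at $r$ and at $-r$; the boundary $r = L$ has only the first.
\<close>

lemma chain_sum_eq_theta_less:
  assumes "i < k"
    and S: "(chain_term l k (chain_weight k i l) (bailey_kernel 0 (nat \<bar>l\<bar>)) has_sum S) ({1..k} \<rightarrow>\<^sub>E UNIV)"
  shows "S = qpoch_inf (- qpow \<tau> (1/2)) q / qpoch_inf q q *
     (\<Sum>\<^sub>\<infinity>r\<in>{nat \<bar>l\<bar>..}. theta_term k i l (int r) - (if r > nat \<bar>l\<bar> then theta_term k i l (- int r) else 0))"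
proof -
  define L where "L = nat \<bar>l\<bar>"
  have L: "real L = \<bar>of_int l\<bar>" "(real L)\<^sup>2 = (of_int l)\<^sup>2" "l \<le> int L" by (simp_all add: L_def)
  define e where "e = (of_int l)\<^sup>2 + real_of_int l"
  define p where "p = k - i - 1"
  have k: "k - i + i = k" "1 + p = k - i" "k - i \<ge> 1" and p: "real p = real k - real i - 1"
    using assms(1) by (auto simp: p_def of_nat_diff)
  let ?w = "chain_weight k i l"
  define \<alpha> where "\<alpha> = (\<lambda>r. qpow \<tau> ((real r)\<^sup>2 - (real L)\<^sup>2 + real i * ((real r)\<^sup>2 + real 1 * real r - e)))"

  have "\<exists>\<beta>'. (chain_term l (k - i) ?w \<beta>' has_sum S) ({1..k - i} \<rightarrow>\<^sub>E UNIV) \<and>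
     bailey_pair L 1 (\<lambda>r. (qpow \<tau> ((real r)\<^sup>2 - (real L)\<^sup>2) * (1 - qpow \<tau> (2 * real r + 1)))
        * qpow \<tau> (real i * ((real r)\<^sup>2 + real 1 * real r - e))) \<beta>'"
  proof (rule has_sum_chain_term_bailey[OF _ _ bailey_pair_unit])
    show "(chain_term l (k - i + i) ?w (bailey_kernel 0 L) has_sum S) ({1..k - i + i} \<rightarrow>\<^sub>E UNIV)"
      unfolding k L_def by (rule S)
    fix j m assume "j \<in> {k - i<..k - i + i}"
    hence "j > k - i" "j \<noteq> 1" using k(3) by auto
    thus "?w j m = qpow \<tau> ((of_int m)\<^sup>2 + real 1 * of_int m - e)"
      by (simp add: chain_weight_def chain_exponent_def e_def algebra_simps)
  qed (use k L in auto)
  then obtain \<beta>1 where \<beta>1: "(chain_term l (k - i) ?w \<beta>1 has_sum S) ({1..k - i} \<rightarrow>\<^sub>E UNIV)"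
     "bailey_pair L 1 (\<lambda>r. (qpow \<tau> ((real r)\<^sup>2 - (real L)\<^sup>2) * (1 - qpow \<tau> (2 * real r + 1)))
        * qpow \<tau> (real i * ((real r)\<^sup>2 + real 1 * real r - e))) \<beta>1" by blast
  have "(\<lambda>r. (qpow \<tau> ((real r)\<^sup>2 - (real L)\<^sup>2) * (1 - qpow \<tau> (2 * real r + 1)))
        * qpow \<tau> (real i * ((real r)\<^sup>2 + real 1 * real r - e))) = (\<lambda>r. \<alpha> r * (1 - qpow \<tau> (2 * real r + 1)))"
    unfolding \<alpha>_def qpow_add by (simp only: mult_ac)
  with \<beta>1(2) have "bailey_pair L 1 (\<lambda>r. \<alpha> r * (1 - qpow \<tau> (2 * real r + 1))) \<beta>1" by simp
  note \<beta>1' = bailey_pair_1_imp_0[OF this]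

  let ?a = "\<lambda>r. (\<alpha> r - (if r > L then qpow \<tau> (2 * real r - 1) * \<alpha> (r - 1) else 0))
        * qpow \<tau> (real p * ((real r)\<^sup>2 + real 0 * real r - (of_int l)\<^sup>2))"
  have "\<exists>\<beta>'. (chain_term l 1 ?w \<beta>' has_sum S) ({1..1} \<rightarrow>\<^sub>E UNIV) \<and> bailey_pair L 0 ?a \<beta>'"
  proof (rule has_sum_chain_term_bailey[OF _ _ \<beta>1'])
    show "(chain_term l (1 + p) ?w \<beta>1 has_sum S) ({1..1 + p} \<rightarrow>\<^sub>E UNIV)"
      unfolding k by (rule \<beta>1)
    fix j m assume "j \<in> {1<..1 + p}"
    hence "\<not> j > k - i" "j \<noteq> 1" using k by auto
    thus "?w j m = qpow \<tau> ((of_int m)\<^sup>2 + real 0 * of_int m - (of_int l)\<^sup>2)"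
      by (simp add: chain_weight_def chain_exponent_def)
  qed (use L in auto)
  then obtain \<beta>2 where \<beta>2: "(chain_term l 1 ?w \<beta>2 has_sum S) ({1..1} \<rightarrow>\<^sub>E UNIV)" "bailey_pair L 0 ?a \<beta>2"
    by blast

  define A where "A = (\<lambda>r. (real r)\<^sup>2 - (of_int l)\<^sup>2 + real i * ((real r)\<^sup>2 + real r - e) + real p * ((real r)\<^sup>2 - (of_int l)\<^sup>2))"
  define B where "B = (\<lambda>r. (real r)\<^sup>2 - (of_int l)\<^sup>2 + real i * ((real r)\<^sup>2 - real r - e) + real p * ((real r)\<^sup>2 - (of_int l)\<^sup>2))"
  have a_eq: "?a r = qpow \<tau> (A r) - (if r > L then qpow \<tau> (B r) else 0)" for r
  proof -
    have "\<alpha> r * qpow \<tau> (real p * ((real r)\<^sup>2 + real 0 * real r - (of_int l)\<^sup>2)) = qpow \<tau> (A r)"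
      unfolding \<alpha>_def A_def qpow_add[symmetric] L(2) by simp
    moreover have "qpow \<tau> (2 * real r - 1) * \<alpha> (r - 1) * qpow \<tau> (real p * ((real r)\<^sup>2 + real 0 * real r - (of_int l)\<^sup>2))
        = qpow \<tau> (B r)" if "r > L"
    proof -
      from that have r: "real (r - 1) = real r - 1" by (simp add: of_nat_diff)
      show ?thesis
        unfolding \<alpha>_def B_def qpow_add[symmetric] L(2) r
        by (rule arg_cong[where f = "qpow \<tau>"]) (simp add: power2_eq_square algebra_simps)
    qed
    ultimately show ?thesis by (simp add: left_diff_distrib)
  qed
  have AB_ge: "x\<^sup>2 - (of_int l)\<^sup>2 + real i * y + real p * (x\<^sup>2 - (of_int l)\<^sup>2) \<ge> x + (- (of_int l)\<^sup>2)"
    if "x \<ge> real L" "y \<ge> 0" "x \<ge> 1 \<or> x = 0" for x y :: real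
  proof -
    have "x\<^sup>2 \<ge> (real L)\<^sup>2" using that by (intro power_mono) auto
    hence "real p * (x\<^sup>2 - (of_int l)\<^sup>2) \<ge> 0" using L by simp
    moreover have "x\<^sup>2 \<ge> x" using that by (auto simp: power2_eq_square)
    moreover have "real i * y \<ge> 0" using that by simp
    ultimately show ?thesis by linarith
  qed
  have A_ge: "A r \<ge> real r + (- (of_int l)\<^sup>2)" if "r \<ge> L" for r
    unfolding A_def
  proof (rule AB_ge)
    have "(real r)\<^sup>2 \<ge> (real L)\<^sup>2" using that by (intro power_mono) auto
    thus "(real r)\<^sup>2 + real r - e \<ge> 0" using L that by (simp add: e_def)
  qed (use that in auto)
  have B_ge: "B r \<ge> real r + (- (of_int l)\<^sup>2)" if "r \<ge> L" "r > L" for r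
    unfolding B_def
  proof (rule AB_ge)
    have "real r - 1 \<ge> real L" using that by simp
    hence "real L * (real L + 1) \<le> (real r - 1) * (real r - 1 + 1)" by (intro mult_mono) auto
    thus "(real r)\<^sup>2 - real r - e \<ge> 0" using L that by (simp add: e_def power2_eq_square algebra_simps)
  qed (use that in auto)
  have a_summable: "(\<lambda>r. norm (?a r)) summable_on {L..}"
    unfolding a_eq by (rule summable_on_norm_qpow_diff[where P = "\<lambda>r. r > L", OF A_ge B_ge])

  define K where "K = qpoch_inf (- qpow \<tau> (1/2)) q / qpoch_inf q q"
  have w1: "?w 1 m = qpow \<tau> ((of_int m)\<^sup>2 / 2 + real 0 * of_int m - (of_int l)\<^sup>2 / 2) *
             qpoch (- qpow \<tau> (1/2)) q (nat m)" for m
    using assms(1) by (simp add: chain_weight_def chain_exponent_def diff_divide_distrib)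
  have "S = (\<Sum>\<^sub>\<infinity>r\<in>{L..}. ?a r * (qpow \<tau> ((real r)\<^sup>2 / 2 + real 0 * real r - (of_int l)\<^sup>2 / 2) *
             qpoch (- qpow \<tau> (1/2)) q r * qpoch_inf (- qpow \<tau> (real r + 1/2 + real 0)) q / qpoch_inf q q))"
    using has_sum_chain_term_1[OF \<beta>2(1)] has_sum_bailey_pair[OF \<beta>2(2) L(3) a_summable, of "(of_int l)\<^sup>2 / 2"]
    unfolding w1 by (rule has_sum_unique)
  also have "\<dots> = (\<Sum>\<^sub>\<infinity>r\<in>{L..}. K * (theta_term k i l (int r) - (if r > L then theta_term k i l (- int r) else 0)))"
  proof (rule infsum_cong)
    fix r assume "r \<in> {L..}"
    let ?h = "qpow \<tau> ((real r)\<^sup>2 / 2 - (of_int l)\<^sup>2 / 2)"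
    have "A r + ((real r)\<^sup>2 / 2 - (of_int l)\<^sup>2 / 2) = theta_exponent k i l (int r)"
      unfolding theta_exponent_eq A_def p e_def by (simp add: field_simps)
    hence 1: "qpow \<tau> (A r) * ?h = theta_term k i l (int r)" unfolding qpow_add[symmetric] by (rule arg_cong)
    have "B r + ((real r)\<^sup>2 / 2 - (of_int l)\<^sup>2 / 2) = theta_exponent k i l (- int r)"
      unfolding theta_exponent_eq B_def p e_def by (simp add: field_simps)
    hence 2: "qpow \<tau> (B r) * ?h = theta_term k i l (- int r)" unfolding qpow_add[symmetric] by (rule arg_cong)
    have "(qpow \<tau> (A r) - (if r > L then qpow \<tau> (B r) else 0)) * ?h =
          theta_term k i l (int r) - (if r > L then theta_term k i l (- int r) else 0)"
      unfolding left_diff_distrib 1 using 2 by simp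
    hence "(qpow \<tau> (A r) - (if r > L then qpow \<tau> (B r) else 0)) * (?h *
        (qpoch (- qpow \<tau> (1/2)) q r * qpoch_inf (- qpow \<tau> (real r + 1/2)) q) / qpoch_inf q q) =
       K * (theta_term k i l (int r) - (if r > L then theta_term k i l (- int r) else 0))"
      unfolding qpoch_inf_half_split K_def by (simp only: times_divide_eq_left times_divide_eq_right mult_ac)
    thus "?a r * (qpow \<tau> ((real r)\<^sup>2 / 2 + real 0 * real r - (of_int l)\<^sup>2 / 2) *
             qpoch (- qpow \<tau> (1/2)) q r * qpoch_inf (- qpow \<tau> (real r + 1/2 + real 0)) q / qpoch_inf q q) =
       K * (theta_term k i l (int r) - (if r > L then theta_term k i l (- int r) else 0))"
      unfolding a_eq by (simp only: of_nat_0 mult_zero_left add_0_right mult.assoc)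
  qed
  finally show ?thesis unfolding infsum_cmult_right' K_def L_def .
qed

text \<open>
The case $i = k$, where the parameter stays $q$. The factor $1 - q^{2r+1}$ of the initial pair splits
as $(1 + q^{r+1/2})(1 - q^{r+1/2})$: the first part completes the infinite product, the second part
gives the theta terms at $r$ and at $-r-1$.
\<close>

lemma chain_sum_eq_theta_diag:
  assumes "k \<ge> 1"
    and S: "(chain_term l k (chain_weight k k l) (bailey_kernel 0 (nat \<bar>l\<bar>)) has_sum S) ({1..k} \<rightarrow>\<^sub>E UNIV)"
  shows "S = qpoch_inf (- qpow \<tau> (1/2)) q / qpoch_inf q q *
     (\<Sum>\<^sub>\<infinity>r\<in>{nat \<bar>l\<bar>..}. theta_term k k l (int r) - theta_term k k l (- int r - 1))"
proof -
  define L where "L = nat \<bar>l\<bar>"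
  have L: "real L = \<bar>of_int l\<bar>" "(real L)\<^sup>2 = (of_int l)\<^sup>2" "l \<le> int L" by (simp_all add: L_def)
  define e where "e = (of_int l)\<^sup>2 + real_of_int l"
  define p where "p = k - 1"
  have k: "1 + p = k" and p: "real p = real k - 1" using assms(1) by (auto simp: p_def of_nat_diff)
  let ?w = "chain_weight k k l"
  let ?a = "\<lambda>r. (qpow \<tau> ((real r)\<^sup>2 - (real L)\<^sup>2) * (1 - qpow \<tau> (2 * real r + 1)))
        * qpow \<tau> (real p * ((real r)\<^sup>2 + real 1 * real r - e))"
  have "\<exists>\<beta>'. (chain_term l 1 ?w \<beta>' has_sum S) ({1..1} \<rightarrow>\<^sub>E UNIV) \<and> bailey_pair L 1 ?a \<beta>'"
  proof (rule has_sum_chain_term_bailey[OF _ _ bailey_pair_unit])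
    show "(chain_term l (1 + p) ?w (bailey_kernel 0 L) has_sum S) ({1..1 + p} \<rightarrow>\<^sub>E UNIV)"
      unfolding k L_def by (rule S)
    fix j m assume "j \<in> {1<..1 + p}"
    thus "?w j m = qpow \<tau> ((of_int m)\<^sup>2 + real 1 * of_int m - e)"
      by (simp add: chain_weight_def chain_exponent_def e_def algebra_simps)
  qed (use L in auto)
  then obtain \<beta> where \<beta>: "(chain_term l 1 ?w \<beta> has_sum S) ({1..1} \<rightarrow>\<^sub>E UNIV)" "bailey_pair L 1 ?a \<beta>"
    by blast

  define A where "A = (\<lambda>r. (real r)\<^sup>2 - (of_int l)\<^sup>2 + real p * ((real r)\<^sup>2 + real r - e))"
  have a_eq: "?a r = qpow \<tau> (A r) - (if True then qpow \<tau> (A r + (2 * real r + 1)) else 0)" for r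
  proof -
    have "qpow \<tau> ((real r)\<^sup>2 - (real L)\<^sup>2) * qpow \<tau> (real p * ((real r)\<^sup>2 + real 1 * real r - e)) = qpow \<tau> (A r)"
      unfolding A_def qpow_add[symmetric] L(2) by simp
    hence "?a r = qpow \<tau> (A r) * (1 - qpow \<tau> (2 * real r + 1))" by (simp only: mult_ac)
    thus ?thesis unfolding if_True qpow_add[of "A r"] by (simp only: right_diff_distrib mult_1_right)
  qed
  have A_ge: "A r \<ge> real r + (- (of_int l)\<^sup>2)" if "r \<ge> L" for r
  proof -
    have "(real r)\<^sup>2 \<ge> (real L)\<^sup>2" using that by (intro power_mono) auto
    hence "real p * ((real r)\<^sup>2 + real r - e) \<ge> 0"
      using L that by (intro mult_nonneg_nonneg) (simp_all add: e_def)
    moreover have "(real r)\<^sup>2 \<ge> real r" by (cases r) (simp_all add: power2_eq_square)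
    ultimately show ?thesis unfolding A_def by linarith
  qed
  have A_ge': "A r + (2 * real r + 1) \<ge> real r + (- (of_int l)\<^sup>2)" if "r \<ge> L" for r
    using A_ge[OF that] by simp
  have a_summable: "(\<lambda>r. norm (?a r)) summable_on {L..}"
    unfolding a_eq by (rule summable_on_norm_qpow_diff[where P = "\<lambda>r. True", OF A_ge A_ge'])

  define K where "K = qpoch_inf (- qpow \<tau> (1/2)) q / qpoch_inf q q"
  define e1 where "e1 = (of_int l)\<^sup>2 / 2 + real_of_int l"
  have w1: "?w 1 m = qpow \<tau> ((of_int m)\<^sup>2 / 2 + real 1 * of_int m - e1) *
             qpoch (- qpow \<tau> (1/2)) q (nat m)" for m
    by (simp add: chain_weight_def chain_exponent_def e1_def diff_divide_distrib algebra_simps)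
  have "S = (\<Sum>\<^sub>\<infinity>r\<in>{L..}. ?a r * (qpow \<tau> ((real r)\<^sup>2 / 2 + real 1 * real r - e1) *
             qpoch (- qpow \<tau> (1/2)) q r * qpoch_inf (- qpow \<tau> (real r + 1/2 + real 1)) q / qpoch_inf q q))"
    using has_sum_chain_term_1[OF \<beta>(1)] has_sum_bailey_pair[OF \<beta>(2) L(3) a_summable, of e1]
    unfolding w1 by (rule has_sum_unique)
  also have "\<dots> = (\<Sum>\<^sub>\<infinity>r\<in>{L..}. K * (theta_term k k l (int r) - theta_term k k l (- int r - 1)))"
  proof (rule infsum_cong)
    fix r assume "r \<in> {L..}"
    define h where "h = qpow \<tau> ((real r)\<^sup>2 / 2 + real 1 * real r - e1)"
    define y where "y = qpow \<tau> (real r + 1/2)"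
    define P where "P = qpoch (- qpow \<tau> (1/2)) q r"
    define R where "R = qpoch_inf (- qpow \<tau> (real r + 1/2 + real 1)) q"
    have "A r + ((real r)\<^sup>2 / 2 + real 1 * real r - e1) = theta_exponent k k l (int r)"
      unfolding theta_exponent_eq A_def p e_def e1_def by (simp add: field_simps)
    hence 1: "qpow \<tau> (A r) * h = theta_term k k l (int r)" unfolding h_def qpow_add[symmetric] by (rule arg_cong)
    have "theta_exponent k k l (int r) + (real r + 1/2) = theta_exponent k k l (- int r - 1)"
      unfolding theta_exponent_eq by (simp add: power2_eq_square field_simps)
    hence 2: "theta_term k k l (int r) * y = theta_term k k l (- int r - 1)" unfolding y_def qpow_add[symmetric] by (rule arg_cong)
    have y2: "qpow \<tau> (2 * real r + 1) = y * y" unfolding y_def qpow_add[symmetric] by simp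
    have "- qpow \<tau> (1/2) * q ^ r = - y"
      unfolding y_def qpow_add qpow_of_nat by simp
    hence "qpoch (- qpow \<tau> (1/2)) q (Suc r) = P * (1 + y)"
      unfolding qpoch_Suc P_def by simp
    moreover have "real (Suc r) + 1/2 = real r + 1/2 + real 1" by simp
    ultimately have 3: "P * (1 + y) * R = qpoch_inf (- qpow \<tau> (1/2)) q"
      using qpoch_inf_half_split[of "Suc r"] unfolding R_def by metis
    have a: "?a r = qpow \<tau> (A r) * ((1 + y) * (1 - y))"
    proof -
      have "?a r = qpow \<tau> (A r) - qpow \<tau> (A r + (2 * real r + 1))"
        using a_eq[of r] by (simp only: if_True)
      also have "\<dots> = qpow \<tau> (A r) * ((1 + y) * (1 - y))"
        unfolding qpow_add[of "A r"] y2 by (simp add: algebra_simps)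
      finally show ?thesis .
    qed
    have "?a r * (h * P * R / qpoch_inf q q) = (qpow \<tau> (A r) * h) * (1 - y) * (P * (1 + y) * R) / qpoch_inf q q"
      unfolding a by (simp only: times_divide_eq_left times_divide_eq_right mult_ac)
    also have "\<dots> = K * (theta_term k k l (int r) - theta_term k k l (- int r - 1))"
      unfolding 1 3 2[symmetric] K_def by (simp add: algebra_simps diff_divide_distrib)
    finally show "?a r * (qpow \<tau> ((real r)\<^sup>2 / 2 + real 1 * real r - e1) *
             qpoch (- qpow \<tau> (1/2)) q r * qpoch_inf (- qpow \<tau> (real r + 1/2 + real 1)) q / qpoch_inf q q)
       = K * (theta_term k k l (int r) - theta_term k k l (- int r - 1))"
      unfolding h_def P_def R_def .
  qed
  finally show ?thesis unfolding infsum_cmult_right' K_def L_def .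
qed

lemma infsum_complex_diff:
  fixes f g :: "'a \<Rightarrow> complex"
  assumes "f summable_on A" "g summable_on A"
  shows "(\<Sum>\<^sub>\<infinity>x\<in>A. f x - g x) = infsum f A - infsum g A"
  using infsum_add[of f A "\<lambda>x. - g x"] assms by (simp add: summable_on_uminus infsum_uminus)

lemma infsum_int_atLeast:
  "(\<Sum>\<^sub>\<infinity>n\<in>{\<bar>l\<bar>..}. f n) = (\<Sum>\<^sub>\<infinity>r\<in>{nat \<bar>l\<bar>..}. f (int r))"
  by (rule infsum_reindex_bij_witness[of _ int nat]) auto

lemma infsum_int_atMost:
  "(\<Sum>\<^sub>\<infinity>n\<in>{..- \<bar>l\<bar> - 1}. f n) = (\<Sum>\<^sub>\<infinity>r\<in>{nat \<bar>l\<bar><..}. f (- int r))"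
  by (rule infsum_reindex_bij_witness[of _ "\<lambda>r. - int r" "\<lambda>n. nat (- n)"]) auto

lemma infsum_int_atMost_shift:
  "(\<Sum>\<^sub>\<infinity>n\<in>{..- \<bar>l\<bar> - 1}. f n) = (\<Sum>\<^sub>\<infinity>r\<in>{nat \<bar>l\<bar>..}. f (- int r - 1))"
  by (rule infsum_reindex_bij_witness[of _ "\<lambda>r. - int r - 1" "\<lambda>n. nat (- n - 1)"]) auto

lemma multisum_eq:
  assumes "k \<ge> 1" "i \<le> k"
  shows "(\<Sum>\<^sub>\<infinity>n\<in>{1..k} \<rightarrow>\<^sub>E UNIV. multisum_term \<tau> k i l n) =
     qpoch_inf (- qpow \<tau> (1/2)) q / qpoch_inf q q
         * ((\<Sum>\<^sub>\<infinity>n\<in>{\<bar>l\<bar>..}. theta_term k i l n) - (\<Sum>\<^sub>\<infinity>n\<in>{..- \<bar>l\<bar> - 1}. theta_term k i l n))"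
proof -
  define S where "S = (\<Sum>\<^sub>\<infinity>n\<in>{1..k} \<rightarrow>\<^sub>E UNIV. multisum_term \<tau> k i l n)"
  define L where "L = nat \<bar>l\<bar>"
  have "(multisum_term \<tau> k i l has_sum S) ({1..k} \<rightarrow>\<^sub>E UNIV)"
    unfolding S_def by (rule has_sum_infsum[OF summable_on_multisum_term[OF assms]])
  hence S: "(chain_term l k (chain_weight k i l) (bailey_kernel 0 (nat \<bar>l\<bar>)) has_sum S) ({1..k} \<rightarrow>\<^sub>E UNIV)"
    unfolding multisum_term_eq_chain_term[OF assms] .
  have reindex: "(\<lambda>r. theta_term k i l (h r)) summable_on A" if "inj_on h A" for h :: "nat \<Rightarrow> int" and A
    using summable_on_reindex[OF that, of "theta_term k i l"] summable_on_theta[OF assms(2), of l "h ` A"]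
    by (simp add: comp_def)
  show ?thesis
  proof (cases "i = k")
    case True
    have "S = qpoch_inf (- qpow \<tau> (1/2)) q / qpoch_inf q q *
     (\<Sum>\<^sub>\<infinity>r\<in>{L..}. theta_term k i l (int r) - theta_term k i l (- int r - 1))"
      using chain_sum_eq_theta_diag[OF assms(1)] S unfolding True L_def by blast
    also have "(\<Sum>\<^sub>\<infinity>r\<in>{L..}. theta_term k i l (int r) - theta_term k i l (- int r - 1)) =
        (\<Sum>\<^sub>\<infinity>r\<in>{L..}. theta_term k i l (int r)) - (\<Sum>\<^sub>\<infinity>r\<in>{L..}. theta_term k i l (- int r - 1))"
      by (intro infsum_complex_diff reindex) (auto simp: inj_on_def)
    finally show ?thesis unfolding S_def L_def infsum_int_atLeast infsum_int_atMost_shift .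
  next
    case False
    with assms have "i < k" by simp
    let ?g = "\<lambda>r. if r > L then theta_term k i l (- int r) else 0"
    have cong: "(?g has_sum x) {L..} \<longleftrightarrow> ((\<lambda>r. theta_term k i l (- int r)) has_sum x) {L<..}" for x
      by (rule has_sum_cong_neutral) auto
    have "((\<lambda>r. theta_term k i l (- int r)) has_sum (\<Sum>\<^sub>\<infinity>r\<in>{L<..}. theta_term k i l (- int r))) {L<..}"
      by (intro has_sum_infsum reindex) (auto simp: inj_on_def)
    hence g: "(?g has_sum (\<Sum>\<^sub>\<infinity>r\<in>{L<..}. theta_term k i l (- int r))) {L..}" using cong by blast
    have "S = qpoch_inf (- qpow \<tau> (1/2)) q / qpoch_inf q q * (\<Sum>\<^sub>\<infinity>r\<in>{L..}. theta_term k i l (int r) - ?g r)"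
      using chain_sum_eq_theta_less[OF \<open>i < k\<close> S] unfolding L_def .
    also have "(\<Sum>\<^sub>\<infinity>r\<in>{L..}. theta_term k i l (int r) - ?g r) =
        (\<Sum>\<^sub>\<infinity>r\<in>{L..}. theta_term k i l (int r)) - (\<Sum>\<^sub>\<infinity>r\<in>{L..}. ?g r)"
      by (intro infsum_complex_diff reindex has_sum_imp_summable[OF g]) (auto simp: inj_on_def)
    also have "(\<Sum>\<^sub>\<infinity>r\<in>{L..}. ?g r) = (\<Sum>\<^sub>\<infinity>r\<in>{L<..}. theta_term k i l (- int r))"
      using g by (rule infsumI)
    finally show ?thesis unfolding S_def L_def infsum_int_atLeast infsum_int_atMost .
  qed
qed

end

theorem proposition3p1:
  fixes \<tau> :: complex and k i :: nat and l :: int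
  assumes "Im \<tau> > 0" and "k \<ge> 1" and "i \<le> k"
  shows "(\<lambda>n. qpow \<tau> (theta_exponent k i l n)) summable_on {\<bar>l\<bar>..} \<and>
         (\<lambda>n. qpow \<tau> (theta_exponent k i l n)) summable_on {..- \<bar>l\<bar> - 1} \<and>
         multisum_term \<tau> k i l summable_on ({1..k} \<rightarrow>\<^sub>E UNIV) \<and>
         qpoch_inf (- qpow \<tau> (1/2)) (qpow \<tau> 1) / qpoch_inf (qpow \<tau> 1) (qpow \<tau> 1)
         * ((\<Sum>\<^sub>\<infinity>n\<in>{\<bar>l\<bar>..}. qpow \<tau> (theta_exponent k i l n))
            - (\<Sum>\<^sub>\<infinity>n\<in>{..- \<bar>l\<bar> - 1}. qpow \<tau> (theta_exponent k i l n)))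
         = (\<Sum>\<^sub>\<infinity>n\<in>{1..k} \<rightarrow>\<^sub>E UNIV. multisum_term \<tau> k i l n)"
proof -
  interpret nome \<tau> by unfold_locales (rule assms(1))
  show ?thesis
    using summable_on_theta[OF assms(3)] summable_on_multisum_term[OF assms(2,3)]
      multisum_eq[OF assms(2,3), of l] by simp
qed

end
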